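(* Let $r\ge1$, $\alpha\in(0,1)$, let $\rho:\mathbb{R}^d\to[0,\infty)$ be a convex penalty function, and let $\|\cdot\|$ be a norm on $\mathbb{R}^{d+1}$ with dual norm $\|\cdot\|_*$ such that, for some $c_d>0$, $c_d\|(\boldsymbol\gamma,-1)\|\le\rho(\boldsymbol\gamma)+1$ for all $\boldsymbol\gamma\in\mathbb{R}^d$. Let $\mathbb{P}$ be a Borel probability measure on $\mathbb{R}^{d+1}$ and $\mathbb{P}_n$ the empirical measure of $n$ i.i.d. draws from $\mathbb{P}$. Suppose that for some $s>2r$, $$\mathbb{E}_{\mathbb{P}}\left[\|(\mathbf{X},0)\|_*^s\right]=1,\qquad\mathbb{E}_{\mathbb{P}}\left[\|(0,\dots,0,Y)\|_*^s\right]^{1/s}<\infty,$$ and set $\sigma=\max\left\{\mathbb{E}_{\mathbb{P}}[\|(0,\dots,0,Y)\|_*^s]^{1/s},\,1\right\}$. Let $$\delta_{n,r}=\max\left\{\tfrac1{c_d},1\right\}\left[\frac{C\log(2n+1)^{r/s}}{\sqrt n}\right]^{1/r},$$ $$C=2^r r\left(180\sqrt{d+2}+\sqrt{2\log(1/\alpha)}+\sqrt{\frac{2^s}{\alpha}}\;\frac{8}{s/2-r}\sqrt{\log(8/\alpha)+(d+2)}\right).$$ Then, for every $\epsilon\ge0$ and every probability measure $\mathbb{Q}$ on $\mathbb{R}^{d+1}$ with $\widehat{\mathcal{W}}_{r,\rho,\sigma}(\mathbb{P},\mathbb{Q})\le\epsilon$, with probability greater than $1-3\alpha$, $$\mathbb{E}_{\mathbb{Q}}\left[|Y-\mathbf{X}^\top\boldsymbol\beta|^r\right]^{1/r}\le\mathbb{E}_{\mathbb{P}_n}\left[|Y-\mathbf{X}^\top\boldsymbol\beta|^r\right]^{1/r}+(\delta_{n,r}+\epsilon)(\sigma+\rho(\boldsymbol\beta))\qquad\text{for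 all }\boldsymbol\beta\in\mathbb{R}^d.$$
   Context: Points of $\mathbb{R}^{d+1}$ are written $(\mathbf{x},y)$ with $\mathbf{x}\in\mathbb{R}^d$, $y\in\mathbb{R}$; $\mathbb{E}_{\mathbb{Q}}$ denotes expectation when $(\mathbf{X},Y)\sim\mathbb{Q}$. The dual norm is $\|\mathbf{x}\|_*=\sup_{\|\mathbf{y}\|=1}\mathbf{x}^\top\mathbf{y}$. $\Pi(\mathbb{P},\widetilde{\mathbb{P}})$ is the set of couplings, i.e. joint laws of $((\mathbf{X},Y),(\widetilde{\mathbf{X}},\widetilde{Y}))$ with marginals $\mathbb{P}$ and $\widetilde{\mathbb{P}}$. The $\rho$-max-sliced Wasserstein distance is $$\widehat{\mathcal{W}}_{r,\rho,\sigma}(\mathbb{P},\widetilde{\mathbb{P}})=\sup_{\boldsymbol\gamma\in\mathbb{R}^d}\ \inf_{\pi\in\Pi(\mathbb{P},\widetilde{\mathbb{P}})}\frac{1}{\sigma+\rho(\boldsymbol\gamma)}\left(\mathbb{E}_\pi\left[\left|(Y-\mathbf{X}^\top\boldsymbol\gamma)-(\widetilde{Y}-\widetilde{\mathbf{X}}^\top\boldsymbol\gamma)\right|^r\right]\right)^{1/r}.$$ The probability in the conclusion is with respect to the i.i.d. sample defining $\mathbb{P}_n$.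
   Formalization: The convex penalty ρ is additionally assumed to satisfy ρ(0)=0; for convex ρ≥0 with ρ(0)>0 the stated bound can fail (e.g. d=1, norm |x|+K|y|, ρ(γ)=|γ|+K−1, c_d=1, X=1, Y uniform on {0, 2^{1/s}K²}, K large). *)

theory Defs
  imports "HOL-Probability.Probability"
begin

text \<open>
  Points of \<open>\<real>\<^sup>d\<^sup>+\<^sup>1\<close> are pairs in \<^typ>\<open>(real^'d) \<times> real\<close>. The library's product topology and
  Borel sets are the usual ones and \<open>(x, y) \<bullet> (x', y') = x \<bullet> x' + y * y'\<close>; the library's
  (Euclidean) \<^const>\<open>norm\<close> is not used, since the norm of the theorem is arbitrary.
\<close>

definition is_norm :: "('a::real_vector \<Rightarrow> real) \<Rightarrow> bool" where
  "is_norm N \<longleftrightarrow>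
     (\<forall>v. N v = 0 \<longleftrightarrow> v = 0) \<and>
     (\<forall>c v. N (c *\<^sub>R v) = \<bar>c\<bar> * N v) \<and>
     (\<forall>v w. N (v + w) \<le> N v + N w)"

definition dual_norm :: "('a::euclidean_space \<Rightarrow> real) \<Rightarrow> 'a \<Rightarrow> real" where
  "dual_norm N x = (SUP y\<in>{y. N y = 1}. x \<bullet> y)"

text \<open>
  A penalty charges nothing for the zero coefficient vector. The normalisation \<open>\<rho> 0 = 0\<close> is not
  cosmetic: together with convexity it gives \<open>\<rho> (\<gamma> /\<^sub>R \<sigma>) \<le> \<rho> \<gamma> / \<sigma>\<close> for \<open>\<sigma> \<ge> 1\<close>, hence
  \<open>c * N (\<gamma>, -\<sigma>) \<le> \<rho> \<gamma> + \<sigma>\<close> from \<open>c * N (\<gamma>, -1) \<le> \<rho> \<gamma> + 1\<close>. For convex \<open>\<rho> \<ge> 0\<close> with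
  \<open>\<rho> 0 > 0\<close> a bound scaled by \<open>\<sigma> + \<rho> \<beta>\<close> can fail: on \<open>\<real>\<^sup>2\<close> take \<open>N (x, y) = \<bar>x\<bar> + K * \<bar>y\<bar>\<close>,
  \<open>\<rho> \<gamma> = \<bar>\<gamma>\<bar> + K - 1\<close>, \<open>c = 1\<close>, \<open>X = 1\<close> and \<open>Y\<close> uniform on \<open>{0, K\<^sup>2 * 2 powr (1 / s)}\<close>; then
  \<open>\<sigma> = K\<close>, while at \<open>\<beta> = 0\<close> the residual moment grows like \<open>K\<^sup>2\<close> and \<open>\<sigma> + \<rho> 0 = 2 * K - 1\<close>.
\<close>

definition convex_penalty :: "('a::real_vector \<Rightarrow> real) \<Rightarrow> bool" where
  "convex_penalty \<rho> \<longleftrightarrow> convex_on UNIV \<rho> \<and> (\<forall>\<gamma>. 0 \<le> \<rho> \<gamma>) \<and> \<rho> 0 = 0"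

text \<open>
  \<open>E[|f|\<^sup>p]\<^sup>1\<^sup>/\<^sup>p\<close> as an extended value: it is \<open>\<infinity>\<close> when the moment is infinite.
\<close>

definition lp_moment :: "real \<Rightarrow> 'a measure \<Rightarrow> ('a \<Rightarrow> real) \<Rightarrow> ennreal" where
  "lp_moment p M f =
     (let m = (\<integral>\<^sup>+ z. ennreal (\<bar>f z\<bar> powr p) \<partial>M)
      in if m = \<infinity> then \<infinity> else ennreal (enn2real m powr (1 / p)))"

definition resid :: "real^'d \<Rightarrow> (real^'d) \<times> real \<Rightarrow> real" where
  "resid \<gamma> z = snd z - fst z \<bullet> \<gamma>"

definition couplings ::
  "'a::topological_space measure \<Rightarrow> 'a measure \<Rightarrow> ('a \<times> 'a) measure set" where
  "couplings P Q =
     {\<pi>. prob_space \<pi> \<and> sets \<pi> = sets (borel \<Otimes>\<^sub>M borel) \<and>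
         distr \<pi> borel fst = P \<and> distr \<pi> borel snd = Q}"

definition max_sliced_wasserstein ::
  "real \<Rightarrow> (real^'d \<Rightarrow> real) \<Rightarrow> real
   \<Rightarrow> ((real^'d) \<times> real) measure \<Rightarrow> ((real^'d) \<times> real) measure \<Rightarrow> ennreal" where
  "max_sliced_wasserstein r \<rho> \<sigma> P Q =
     (SUP \<gamma>. INF \<pi>\<in>couplings P Q.
        ennreal (1 / (\<sigma> + \<rho> \<gamma>)) * lp_moment r \<pi> (\<lambda>(z, z'). resid \<gamma> z - resid \<gamma> z'))"

definition empirical_measure :: "nat \<Rightarrow> (nat \<Rightarrow> 'a::topological_space) \<Rightarrow> 'a measure" where
  "empirical_measure n z = distr (uniform_count_measure {..<n}) borel z"

end

theory Submission
  imports Defs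
begin

text \<open>
  Two comparisons make up the bound. Passing from \<open>Q\<close> to \<open>P\<close> is deterministic: along a coupling
  that is nearly optimal for \<open>\<beta>\<close>, the residuals under \<open>P\<close> and \<open>Q\<close> differ in \<open>L\<^sup>r\<close> by
  hardly more than \<open>\<epsilon> * (\<sigma> + \<rho> \<beta>)\<close>, and Minkowski's inequality does the rest
  (\<open>lp_moment_resid_wasserstein\<close>). What remains is to bound population moments by empirical
  moments, uniformly in \<open>\<beta>\<close>.

  For that, put \<open>w = (x, y / \<sigma>)\<close> and \<open>u\<^sub>\<beta> = c\<^sub>d / (\<sigma> + \<rho> \<beta>) * (\<beta>, - \<sigma>)\<close>, so that the residual is
  a multiple of \<open>w \<bullet> u\<^sub>\<beta>\<close>. Convexity of \<open>\<rho>\<close> and \<open>\<rho> 0 = 0\<close> give \<open>N u\<^sub>\<beta> \<le> 1\<close>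
  (\<open>penalty_dominates_scaled_norm\<close>), hence all these linear forms lie below one envelope
  \<open>D = \<parallel>(x, 0)\<parallel>\<^sub>* + \<parallel>(0, y)\<parallel>\<^sub>* / \<sigma>\<close>, and \<open>s > 2 * r\<close> gives \<open>E[D\<^sup>2\<^sup>r] \<le> 2 * 4\<^sup>r\<close>
  (\<open>envelope_second_moment\<close>). Since \<open>t \<mapsto> t\<^sup>1\<^sup>/\<^sup>r\<close> is subadditive, it is enough that
  \<open>S = sup\<^sub>\<beta> (\<Sum>i<n. E[\<bar>w \<bullet> u\<^sub>\<beta>\<bar>\<^sup>r] - \<bar>w\<^sub>i \<bullet> u\<^sub>\<beta>\<bar>\<^sup>r)\<close> is at most \<open>T = sqrt n * C * ln (2 * n + 1)\<^sup>r\<^sup>/\<^sup>s\<close>.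

  The positive part of \<open>S\<close> is controlled through its second moment. A ghost sample and random
  exchanges of the two samples replace \<open>S\<close> by a Rademacher process
  (\<open>symmetrization_second_moment\<close>). As \<open>t \<mapsto> \<bar>t\<bar>\<^sup>r\<close> is \<open>r * D\<^sup>r\<^sup>-\<^sup>1\<close>-Lipschitz on \<open>[- D, D]\<close>, the contraction
  principle (\<open>rademacher_contraction\<close>) replaces the \<open>r\<close>-th powers by linear forms. The supremum of
  a linear Rademacher process over a set of directions costs one factor, the dimension
  (\<open>linear_rademacher_bound\<close>): in coordinates that are orthonormal for the empirical quadratic form,
  Cauchy-Schwarz bounds its square by the largest value of that form times the squared length of the
  projection of the sign vector to a space of dimension at most \<open>d + 1\<close>. Altogether \<open>E[(max 0 S)\<^sup>2] \<le> 4 * n * (d + 1) * r\<^sup>2 * E[D\<^sup>2\<^sup>r]\<close>, and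
  Markov's inequality for the square bounds the probability of \<open>S > T\<close> by \<open>\<alpha>\<close>. It is the last summand of \<open>C\<close>, which grows like \<open>1 / sqrt \<alpha>\<close>, that pays for using
  a second moment (\<open>sample_constant_bound\<close>).

  Suprema are taken over finite, then countable sets of \<open>\<beta>\<close>. Both sides of the claim are continuous
  in \<open>\<beta>\<close>, so a countable dense set suffices; this also makes the event of the theorem measurable.
\<close>

section \<open>Contraction for Rademacher sums\<close>

text \<open>
  Convexity compares increments over intervals of equal length, and monotonicity absorbs the excess
  length of \<open>[a', b']\<close>.
\<close>

lemma convex_mono_increment:
  fixes G :: "real \<Rightarrow> real"
  assumes "convex_on UNIV G" "mono G" "a \<le> a'" "a \<le> b" "b - a \<le> b' - a'"
  shows "G b + G a' \<le> G a + G b'"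
proof -
  define h where "h = b - a"
  have "h \<ge> 0" using assms by (simp add: h_def)
  have "G (a + h) + G a' \<le> G a + G (a' + h)"
  proof (cases "a' + h = a")
    case True
    then have "h = 0" "a' = a" using \<open>h \<ge> 0\<close> assms(3) by linarith+
    then show ?thesis by simp
  next
    case False
    define L where "L = a' + h - a"
    have "L > 0" using False \<open>h \<ge> 0\<close> assms(3) by (simp add: L_def)
    define t where "t = h / L"
    have t: "0 \<le> t" "t \<le> 1" using \<open>L > 0\<close> \<open>h \<ge> 0\<close> assms(3) by (auto simp: t_def L_def)
    have tL: "t * L = h" using \<open>L > 0\<close> by (simp add: t_def)
    have e1: "(1 - t) *\<^sub>R a + t *\<^sub>R (a + L) = a + h" using tL by (simp add: algebra_simps)
    have e2: "(1 - (1 - t)) *\<^sub>R a + (1 - t) *\<^sub>R (a + L) = a'" using tL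
      by (simp add: algebra_simps L_def)
    have "G (a + h) \<le> (1 - t) * G a + t * G (a + L)"
      using convex_onD[OF assms(1) t, of a "a + L"] e1 by simp
    moreover have "G a' \<le> (1 - (1 - t)) * G a + (1 - t) * G (a + L)"
      using convex_onD[OF assms(1), of "1 - t" a "a + L"] t e2 by simp
    ultimately have "G (a + h) + G a' \<le> G a + G (a + L)" by (simp add: algebra_simps)
    then show ?thesis by (simp add: L_def algebra_simps)
  qed
  moreover have "G (a' + h) \<le> G b'"
    using assms(5) by (intro monoD[OF assms(2)]) (simp add: h_def)
  ultimately show ?thesis by (simp add: h_def)
qed

text \<open>
  One random sign. The maxima on the left are attained, at \<open>u\<close> and \<open>v\<close> say. If \<open>h u\<close> and \<open>h v\<close> have
  different signs, monotonicity of \<open>G\<close> suffices. Otherwise replacing \<open>g\<close> by \<open>h\<close> lowers one of the two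
  arguments and raises the other by at least as much, and the raised one lies further right; so the
  convexity of \<open>G\<close> makes the sum grow.
\<close>

lemma contraction_step:
  fixes b g h :: "'u \<Rightarrow> real"
  assumes G: "convex_on UNIV G" "mono G" and U: "finite U" "U \<noteq> {}"
    and gh: "\<And>u. u \<in> U \<Longrightarrow> \<bar>g u\<bar> \<le> \<bar>h u\<bar>"
    and lip: "\<And>u v. u \<in> U \<Longrightarrow> v \<in> U \<Longrightarrow> \<bar>g u - g v\<bar> \<le> \<bar>h u - h v\<bar>"
  shows "G (MAX u\<in>U. b u + g u) + G (MAX u\<in>U. b u - g u)
           \<le> G (MAX u\<in>U. b u + h u) + G (MAX u\<in>U. b u - h u)"
proof -
  have att: "\<exists>w\<in>U. (MAX u\<in>U. F u) = F w" for F :: "'u \<Rightarrow> real"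
  proof -
    have "(MAX u\<in>U. F u) \<in> F ` U" using U by (intro Max_in) auto
    then show ?thesis by auto
  qed
  have ub: "F w \<le> (MAX u\<in>U. F u)" if "w \<in> U" for F :: "'u \<Rightarrow> real" and w
    using U that by (intro Max_ge) auto
  obtain u where u: "u \<in> U" "(MAX u\<in>U. b u + g u) = b u + g u"
    using att[of "\<lambda>u. b u + g u"] by blast
  obtain v where v: "v \<in> U" "(MAX u\<in>U. b u - g u) = b v - g v"
    using att[of "\<lambda>u. b u - g u"] by blast
  \<comment> \<open>Optimality of \<open>u\<close> and \<open>v\<close> is what orders the two intervals compared by convexity.\<close>
  have opt: "b v + g v \<le> b u + g u" "b u - g u \<le> b v - g v"
    using ub[OF v(1), of "\<lambda>u. b u + g u"] ub[OF u(1), of "\<lambda>u. b u - g u"]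
    unfolding u(2) v(2) .
  define Mp Mm where "Mp = (MAX u\<in>U. b u + h u)" and "Mm = (MAX u\<in>U. b u - h u)"
  have bnd: "b w + h w \<le> Mp" "b w - h w \<le> Mm" if "w \<in> U" for w
    using ub[OF that, of "\<lambda>u. b u + h u"] ub[OF that, of "\<lambda>u. b u - h u"]
    unfolding Mp_def Mm_def .
  have mono: "G x \<le> G y" if "x \<le> y" for x y using monoD[OF G(2) that] .
  note inc = convex_mono_increment[OF G]
  note facts = gh[OF u(1)] gh[OF v(1)] lip[OF u(1) v(1)] opt bnd[OF u(1)] bnd[OF v(1)]
  have "G (b u + g u) + G (b v - g v) \<le> G Mp + G Mm"
  proof -
    consider "h u \<ge> 0" "h v \<le> 0" | "h u \<le> 0" "h v \<ge> 0"
      | "h v \<ge> 0" "h u \<ge> h v" | "h u \<ge> 0" "h v \<ge> h u"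
      | "h v \<le> 0" "h u \<le> h v" | "h u \<le> 0" "h v \<le> h u" by linarith
    then show ?thesis
    proof cases
      case 1
      then have "b u + g u \<le> Mp" "b v - g v \<le> Mm" using facts by linarith+
      then show ?thesis using mono by (meson add_mono)
    next
      case 2
      then have "b u + g u \<le> Mm" "b v - g v \<le> Mp" using facts by linarith+
      then show ?thesis using mono[of "b u + g u" Mm] mono[of "b v - g v" Mp] by linarith
    next
      case 3
      have "G (b v - g v) + G (b u + g u) \<le> G (b v - h v) + G (b u + h u)"
        using 3 facts by (intro inc) linarith+
      then show ?thesis using mono[OF bnd(1)[OF u(1)]] mono[OF bnd(2)[OF v(1)]] by linarith
    next
      case 4
      have "G (b u + g u) + G (b v - g v) \<le> G (b u - h u) + G (b v + h v)"
        using 4 facts by (intro inc) linarith+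
      then show ?thesis using mono[OF bnd(1)[OF v(1)]] mono[OF bnd(2)[OF u(1)]] by linarith
    next
      case 5
      have "G (b v - g v) + G (b u + g u) \<le> G (b v + h v) + G (b u - h u)"
        using 5 facts by (intro inc) linarith+
      then show ?thesis using mono[OF bnd(1)[OF v(1)]] mono[OF bnd(2)[OF u(1)]] by linarith
    next
      case 6
      have "G (b u + g u) + G (b v - g v) \<le> G (b u + h u) + G (b v - h v)"
        using 6 facts by (intro inc) linarith+
      then show ?thesis using mono[OF bnd(1)[OF u(1)]] mono[OF bnd(2)[OF v(1)]] by linarith
    qed
  qed
  then show ?thesis using u(2) v(2) by (simp add: Mp_def Mm_def)
qed

text \<open>
  A sign vector, encoded by the set of its positive entries: averaging over independent fair signs on
  \<open>I\<close> is averaging over \<open>Pow I\<close>.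
\<close>

definition rsign :: "'i set \<Rightarrow> 'i \<Rightarrow> real" where
  "rsign A i = (if i \<in> A then 1 else -1)"

lemma sum_Pow_insert:
  assumes "finite I" "k \<notin> I"
  shows "(\<Sum>A\<in>Pow (insert k I). F A) = (\<Sum>A\<in>Pow I. F (insert k A) + F A)"
proof -
  have "(\<Sum>A\<in>Pow (insert k I). F A) = (\<Sum>A\<in>Pow I. F A) + (\<Sum>A\<in>insert k ` Pow I. F A)"
    unfolding Pow_insert using assms by (intro sum.union_disjoint) auto
  also have "(\<Sum>A\<in>insert k ` Pow I. F A) = (\<Sum>A\<in>Pow I. F (insert k A))"
    using assms by (intro sum.reindex_cong[of "insert k"]) (auto simp: inj_on_def)
  finally show ?thesis by (simp add: sum.distrib add.commute)
qed

lemma sum_rsign_insert: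
  assumes "finite I" "k \<notin> I" "A \<subseteq> I"
  shows "(\<Sum>i\<in>insert k I. rsign (insert k A) i * c i) = c k + (\<Sum>i\<in>I. rsign A i * c i)"
    and "(\<Sum>i\<in>insert k I. rsign A i * c i) = - c k + (\<Sum>i\<in>I. rsign A i * c i)"
proof -
  have "(\<Sum>i\<in>I. rsign (insert k A) i * c i) = (\<Sum>i\<in>I. rsign A i * c i)"
    using assms(2) by (intro sum.cong) (auto simp: rsign_def)
  then show "(\<Sum>i\<in>insert k I. rsign (insert k A) i * c i) = c k + (\<Sum>i\<in>I. rsign A i * c i)"
    using assms by (simp add: rsign_def)
  show "(\<Sum>i\<in>insert k I. rsign A i * c i) = - c k + (\<Sum>i\<in>I. rsign A i * c i)"
    using assms by (auto simp: rsign_def)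
qed

text \<open>
  The contraction principle of Ledoux and Talagrand, with unnormalised averages. The signs are treated
  one at a time; the offset \<open>b\<close> carries the part of the process whose signs are held fixed, which is
  why it is general in the induction.
\<close>

lemma rademacher_contraction:
  fixes b :: "'u \<Rightarrow> real" and g h :: "'i \<Rightarrow> 'u \<Rightarrow> real"
  assumes G: "convex_on UNIV G" "mono G" and U: "finite U" "U \<noteq> {}" and "finite I"
    and gh: "\<And>i u. i \<in> I \<Longrightarrow> u \<in> U \<Longrightarrow> \<bar>g i u\<bar> \<le> \<bar>h i u\<bar>"
    and lip: "\<And>i u v. i \<in> I \<Longrightarrow> u \<in> U \<Longrightarrow> v \<in> U \<Longrightarrow> \<bar>g i u - g i v\<bar> \<le> \<bar>h i u - h i v\<bar>"
  shows "(\<Sum>A\<in>Pow I. G (MAX u\<in>U. b u + (\<Sum>i\<in>I. rsign A i * g i u)))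
           \<le> (\<Sum>A\<in>Pow I. G (MAX u\<in>U. b u + (\<Sum>i\<in>I. rsign A i * h i u)))"
  using \<open>finite I\<close> gh lip
proof (induction I arbitrary: b rule: finite_induct)
  case empty
  then show ?case by simp
next
  case (insert k I)
  have IH: "(\<Sum>A\<in>Pow I. G (MAX u\<in>U. b u + (\<Sum>i\<in>I. rsign A i * g i u)))
           \<le> (\<Sum>A\<in>Pow I. G (MAX u\<in>U. b u + (\<Sum>i\<in>I. rsign A i * h i u)))" for b
    using insert.IH insert.prems by blast
  have split: "(\<Sum>A\<in>Pow (insert k I). G (MAX u\<in>U. b u + (\<Sum>i\<in>insert k I. rsign A i * f i u)))
    = (\<Sum>A\<in>Pow I. G (MAX u\<in>U. (b u + f k u) + (\<Sum>i\<in>I. rsign A i * f i u))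
       + G (MAX u\<in>U. (b u - f k u) + (\<Sum>i\<in>I. rsign A i * f i u)))" for f :: "'i \<Rightarrow> 'u \<Rightarrow> real"
    unfolding sum_Pow_insert[OF insert.hyps]
  proof (rule sum.cong[OF refl])
    fix A assume "A \<in> Pow I"
    then have "A \<subseteq> I" by simp
    show "G (MAX u\<in>U. b u + (\<Sum>i\<in>insert k I. rsign (insert k A) i * f i u))
        + G (MAX u\<in>U. b u + (\<Sum>i\<in>insert k I. rsign A i * f i u))
      = G (MAX u\<in>U. (b u + f k u) + (\<Sum>i\<in>I. rsign A i * f i u))
        + G (MAX u\<in>U. (b u - f k u) + (\<Sum>i\<in>I. rsign A i * f i u))"
      unfolding sum_rsign_insert[OF insert.hyps \<open>A \<subseteq> I\<close>] by (simp only: add.assoc diff_conv_add_uminus)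
  qed
  have "(\<Sum>A\<in>Pow (insert k I). G (MAX u\<in>U. b u + (\<Sum>i\<in>insert k I. rsign A i * g i u)))
    \<le> (\<Sum>A\<in>Pow I. G (MAX u\<in>U. (b u + g k u) + (\<Sum>i\<in>I. rsign A i * h i u))
       + G (MAX u\<in>U. (b u - g k u) + (\<Sum>i\<in>I. rsign A i * h i u)))"
    unfolding split sum.distrib by (intro add_mono IH)
  also have "\<dots> \<le> (\<Sum>A\<in>Pow I. G (MAX u\<in>U. (b u + h k u) + (\<Sum>i\<in>I. rsign A i * h i u))
       + G (MAX u\<in>U. (b u - h k u) + (\<Sum>i\<in>I. rsign A i * h i u)))"
  proof (rule sum_mono)
    fix A
    show "G (MAX u\<in>U. (b u + g k u) + (\<Sum>i\<in>I. rsign A i * h i u))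
       + G (MAX u\<in>U. (b u - g k u) + (\<Sum>i\<in>I. rsign A i * h i u))
      \<le> G (MAX u\<in>U. (b u + h k u) + (\<Sum>i\<in>I. rsign A i * h i u))
       + G (MAX u\<in>U. (b u - h k u) + (\<Sum>i\<in>I. rsign A i * h i u))"
      using contraction_step[OF G U, of "g k" "h k" "\<lambda>u. b u + (\<Sum>i\<in>I. rsign A i * h i u)"]
        insert.prems by (simp add: algebra_simps)
  qed
  finally show ?case unfolding split .
qed

section \<open>Linear Rademacher processes\<close>

lemma sum_Pow_rademacher_square:
  assumes "finite I"
  shows "(\<Sum>A\<in>Pow I. (\<Sum>i\<in>I. rsign A i * c i)\<^sup>2) = 2 ^ card I * (\<Sum>i\<in>I. (c i)\<^sup>2)"
  using assms
proof (induction I rule: finite_induct)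
  case (insert k I)
  have "(\<Sum>A\<in>Pow (insert k I). (\<Sum>i\<in>insert k I. rsign A i * c i)\<^sup>2)
     = (\<Sum>A\<in>Pow I. (c k + (\<Sum>i\<in>I. rsign A i * c i))\<^sup>2 + (- c k + (\<Sum>i\<in>I. rsign A i * c i))\<^sup>2)"
    unfolding sum_Pow_insert[OF insert.hyps] using sum_rsign_insert[OF insert.hyps]
    by (intro sum.cong) auto
  also have "\<dots> = (\<Sum>A\<in>Pow I. 2 * (c k)\<^sup>2 + 2 * (\<Sum>i\<in>I. rsign A i * c i)\<^sup>2)"
    by (intro sum.cong) (auto simp: power2_eq_square algebra_simps)
  also have "\<dots> = 2 ^ card I * (2 * (c k)\<^sup>2) + 2 * (\<Sum>A\<in>Pow I. (\<Sum>i\<in>I. rsign A i * c i)\<^sup>2)"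
    using insert.hyps by (simp add: sum.distrib sum_distrib_left card_Pow)
  finally show ?case using insert by (simp add: algebra_simps)
qed simp

text \<open>
  Gram-Schmidt for the form \<open>q\<close>, which is only positive semidefinite: a new vector with a
  \<open>q\<close>-null remainder is dropped, as every \<open>h i\<close> vanishes on that remainder. The expansion is therefore claimed for the values
  \<open>h i u\<close> and not for \<open>u\<close> itself.
\<close>

lemma semi_orthonormal_expansion:
  fixes h :: "'i \<Rightarrow> 'a::real_vector \<Rightarrow> real"
  assumes lin: "\<And>i. i \<in> I \<Longrightarrow> linear (h i)" and "finite I" and "finite F"
  defines "q \<equiv> (\<lambda>u v. \<Sum>i\<in>I. h i u * h i v)"
  shows "\<exists>E. finite E \<and> card E \<le> card F \<and>
           (\<forall>e\<in>E. \<forall>e'\<in>E. q e e' = (if e = e' then 1 else 0)) \<and>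
           (\<forall>u\<in>span F. \<forall>i\<in>I. h i u = (\<Sum>e\<in>E. q u e * h i e))"
  using \<open>finite F\<close>
proof (induction F rule: finite_induct)
  case empty
  have "h i 0 = 0" if "i \<in> I" for i using linear_0[OF lin[OF that]] .
  then show ?case by (intro exI[of _ "{}"]) auto
next
  case (insert b F)
  then obtain E where E: "finite E" "card E \<le> card F"
    "\<And>e e'. e \<in> E \<Longrightarrow> e' \<in> E \<Longrightarrow> q e e' = (if e = e' then 1 else 0)"
    "\<And>u i. u \<in> span F \<Longrightarrow> i \<in> I \<Longrightarrow> h i u = (\<Sum>e\<in>E. q u e * h i e)" by blast
  have qI: "q u v = (\<Sum>i\<in>I. h i u * h i v)" for u v by (simp add: q_def)
  have qsym: "q u v = q v u" for u v by (simp add: q_def mult.commute)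
  have qadd: "q (u + v) w = q u w + q v w" for u v w
    by (simp add: q_def linear_add[OF lin] algebra_simps sum.distrib)
  have qdiff: "q (u - v) w = q u w - q v w" for u v w
    by (simp add: q_def linear_diff[OF lin] algebra_simps sum_subtractf)
  have qscale: "q (c *\<^sub>R u) w = c * q u w" for c u w
    by (simp add: q_def linear_cmul[OF lin] sum_distrib_left algebra_simps)
  have qsum: "q (\<Sum>e\<in>E. f e *\<^sub>R e) w = (\<Sum>e\<in>E. f e * q e w)" for f w
    using \<open>finite E\<close>
    by (induction E rule: finite_induct) (simp_all add: qadd qscale, simp add: q_def linear_0[OF lin])
  define b' where "b' = b - (\<Sum>e\<in>E. q b e *\<^sub>R e)"
  have b'E: "q b' e = 0" if "e \<in> E" for e
  proof -
    have "(\<Sum>e'\<in>E. q b e' * q e' e) = (\<Sum>e'\<in>E. if e' = e then q b e' else 0)"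
      using E(3) that by (intro sum.cong) auto
    then show ?thesis using that E(1) by (simp add: b'_def qdiff qsum)
  qed
  have hb: "h i b = h i b' + (\<Sum>e\<in>E. q b e * h i e)" if "i \<in> I" for i
    by (simp add: b'_def linear_diff[OF lin[OF that]] linear_sum[OF lin[OF that]]
        linear_cmul[OF lin[OF that]])
  have uspan: "\<exists>k. u - k *\<^sub>R b \<in> span F" if "u \<in> span (insert b F)" for u
    using that by (simp add: span_insert)
  show ?case
  proof (cases "q b' b' = 0")
    case True
    then have "(\<Sum>i\<in>I. (h i b')\<^sup>2) = 0" by (simp add: q_def power2_eq_square)
    then have b'0: "h i b' = 0" if "i \<in> I" for i
      using that \<open>finite I\<close> by (simp add: sum_nonneg_eq_0_iff)
    have exp: "h i u = (\<Sum>e\<in>E. q u e * h i e)" if u: "u \<in> span (insert b F)" and i: "i \<in> I" for u i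
    proof -
      obtain k where k: "u - k *\<^sub>R b \<in> span F" using uspan[OF u] by blast
      have "h i u = h i (u - k *\<^sub>R b) + k * h i b"
        by (simp add: linear_diff[OF lin[OF i]] linear_cmul[OF lin[OF i]])
      also have "\<dots> = (\<Sum>e\<in>E. q (u - k *\<^sub>R b) e * h i e) + k * (\<Sum>e\<in>E. q b e * h i e)"
        using E(4)[OF k i] hb[OF i] b'0[OF i] by simp
      also have "\<dots> = (\<Sum>e\<in>E. q u e * h i e)"
        by (simp add: qdiff qscale algebra_simps sum_subtractf sum_distrib_left)
      finally show ?thesis .
    qed
    have crd: "card E \<le> card (insert b F)" using E(2) insert.hyps by simp
    show ?thesis by (intro exI[of _ E] conjI ballI E(1,3) exp crd)
  next
    case False
    have "q b' b' \<ge> 0" by (simp add: q_def sum_nonneg)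
    then have pos: "q b' b' > 0" using False by simp
    define s where "s = sqrt (q b' b')"
    have s: "s > 0" "s * s = q b' b'" using pos by (auto simp: s_def)
    define e0 where "e0 = (1 / s) *\<^sub>R b'"
    have e0E: "q e0 e = 0" if "e \<in> E" for e using b'E[OF that] by (simp add: e0_def qscale)
    have e0e0: "q e0 e0 = 1"
    proof -
      have "q e0 e0 = (1 / s) * ((1 / s) * q b' b')"
        unfolding e0_def qscale by (subst qsym) (simp add: qscale)
      then show ?thesis using s pos by (simp add: field_simps)
    qed
    have e0notin: "e0 \<notin> E" using e0E[of e0] e0e0 by auto
    have Ee0: "q e e0 = 0" if "e \<in> E" for e using e0E[OF that] qsym[of e e0] by simp
    have exp: "h i u = (\<Sum>e\<in>insert e0 E. q u e * h i e)" if u: "u \<in> span (insert b F)" and i: "i \<in> I" for u i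
    proof -
      obtain k where k: "u - k *\<^sub>R b \<in> span F" using uspan[OF u] by blast
      have Fe0: "q (u - k *\<^sub>R b) e0 = 0"
      proof -
        have "q (u - k *\<^sub>R b) e0 = (\<Sum>j\<in>I. (\<Sum>e\<in>E. q (u - k *\<^sub>R b) e * h j e) * h j e0)"
          unfolding qI[of "u - k *\<^sub>R b" e0] using E(4)[OF k] by (intro sum.cong) auto
        also have "\<dots> = (\<Sum>e\<in>E. \<Sum>j\<in>I. q (u - k *\<^sub>R b) e * (h j e * h j e0))"
          unfolding sum_distrib_right by (subst sum.swap) (simp add: mult.assoc)
        also have "\<dots> = (\<Sum>e\<in>E. q (u - k *\<^sub>R b) e * q e e0)"
          by (simp only: qI[of _ e0] sum_distrib_left)
        also have "\<dots> = 0" using Ee0 by simp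
        finally show ?thesis .
      qed
      have qbe0: "q b e0 = s"
      proof -
        have "q b e0 = q b' e0 + (\<Sum>e\<in>E. q b e * q e e0)"
          by (simp add: b'_def qdiff qsum)
        also have "(\<Sum>e\<in>E. q b e * q e e0) = 0" using Ee0 by simp
        also have "q b' e0 = (1 / s) * q b' b'" unfolding e0_def by (subst qsym) (simp add: qscale)
        also have "\<dots> = s" using s by (simp add: field_simps)
        finally show ?thesis by simp
      qed
      have hb': "h i b' = s * h i e0" using s by (simp add: e0_def linear_cmul[OF lin[OF i]])
      have que0: "q u e0 = k * s" using Fe0 qbe0 by (simp add: qdiff qscale)
      have "h i u = h i (u - k *\<^sub>R b) + k * h i b"
        by (simp add: linear_diff[OF lin[OF i]] linear_cmul[OF lin[OF i]])
      also have "\<dots> = (\<Sum>e\<in>E. q (u - k *\<^sub>R b) e * h i e) + k * (\<Sum>e\<in>E. q b e * h i e) + k * s * h i e0"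
        using E(4)[OF k i] hb[OF i] hb' by (simp add: algebra_simps)
      also have "\<dots> = (\<Sum>e\<in>E. q u e * h i e) + q u e0 * h i e0"
        by (simp add: qdiff qscale algebra_simps sum_subtractf sum_distrib_left que0)
      finally show ?thesis using E(1) e0notin by simp
    qed
    have ort: "q e e' = (if e = e' then 1 else 0)" if "e \<in> insert e0 E" "e' \<in> insert e0 E" for e e'
      using that E(3)[of e e'] e0E[of e'] Ee0[of e] e0e0 e0notin by auto
    have crd: "card (insert e0 E) \<le> card (insert b F)"
      using E(1,2) insert.hyps e0notin by simp
    show ?thesis
      by (intro exI[of _ "insert e0 E"] conjI ballI finite.insertI E(1) exp ort crd)
  qed
qed

text \<open>
  In a \<open>q\<close>-orthonormal system \<open>E\<close> the process is \<open>\<Sum>e\<in>E. q u e * (\<Sum>i\<in>I. rsign A i * h i e)\<close>. By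
  Cauchy-Schwarz its square is at most \<open>q u u \<le> B\<close> times \<open>\<Sum>e\<in>E. (\<Sum>i\<in>I. rsign A i * h i e)\<^sup>2\<close>, a quantity
  that is free of \<open>u\<close> and averages to \<open>\<Sum>e\<in>E. q e e = card E\<close>.
\<close>

lemma linear_rademacher_bound:
  fixes h :: "'i \<Rightarrow> 'a::euclidean_space \<Rightarrow> real" and B :: real
  assumes lin: "\<And>i. i \<in> I \<Longrightarrow> linear (h i)" and "finite I"
    and U: "finite U" "U \<noteq> {}" and B: "\<And>u. u \<in> U \<Longrightarrow> (\<Sum>i\<in>I. (h i u)\<^sup>2) \<le> B"
  shows "(\<Sum>A\<in>Pow I. (max 0 (MAX u\<in>U. \<Sum>i\<in>I. rsign A i * h i u))\<^sup>2) \<le> 2 ^ card I * (DIM('a) * B)"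
proof -
  define q where "q = (\<lambda>u v. \<Sum>i\<in>I. h i u * h i v)"
  have "\<exists>E. finite E \<and> card E \<le> card (Basis :: 'a set) \<and>
      (\<forall>e\<in>E. \<forall>e'\<in>E. q e e' = (if e = e' then 1 else 0)) \<and>
      (\<forall>u\<in>span (Basis :: 'a set). \<forall>i\<in>I. h i u = (\<Sum>e\<in>E. q u e * h i e))"
    unfolding q_def by (rule semi_orthonormal_expansion) (use lin \<open>finite I\<close> in auto)
  then obtain E where E0: "finite E" "card E \<le> card (Basis :: 'a set)"
    "\<forall>e\<in>E. \<forall>e'\<in>E. q e e' = (if e = e' then 1 else 0)"
    "\<forall>u\<in>span (Basis :: 'a set). \<forall>i\<in>I. h i u = (\<Sum>e\<in>E. q u e * h i e)"
    by (elim exE conjE)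
  have E: "finite E" "card E \<le> DIM('a)" "\<And>e. e \<in> E \<Longrightarrow> q e e = 1"
    using E0(1-3) by simp_all
  have hE: "h i u = (\<Sum>e\<in>E. q u e * h i e)" if "i \<in> I" for i u
    by (rule bspec[OF bspec[OF E0(4)] that]) simp
  have "B \<ge> 0" 
  proof -
    obtain u where "u \<in> U" using U by blast
    then show ?thesis using B[of u] sum_nonneg[of I "\<lambda>i. (h i u)\<^sup>2"] by simp
  qed
  have qq: "(\<Sum>e\<in>E. (q u e)\<^sup>2) \<le> B" if "u \<in> U" for u
  proof -
    have "(\<Sum>e\<in>E. (q u e)\<^sup>2) = (\<Sum>e\<in>E. \<Sum>i\<in>I. q u e * (h i u * h i e))"
      by (simp add: power2_eq_square q_def sum_distrib_left)
    also have "\<dots> = (\<Sum>i\<in>I. h i u * (\<Sum>e\<in>E. q u e * h i e))"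
      by (subst sum.swap) (simp add: sum_distrib_left algebra_simps)
    also have "\<dots> = (\<Sum>i\<in>I. (h i u)\<^sup>2)"
      by (intro sum.cong refl) (simp only: hE[symmetric] power2_eq_square)
    finally show ?thesis using B[OF that] by simp
  qed
  have pt: "(max 0 (MAX u\<in>U. \<Sum>i\<in>I. rsign A i * h i u))\<^sup>2 \<le> B * (\<Sum>e\<in>E. (\<Sum>i\<in>I. rsign A i * h i e)\<^sup>2)"
    for A
  proof -
    let ?R = "B * (\<Sum>e\<in>E. (\<Sum>i\<in>I. rsign A i * h i e)\<^sup>2)"
    have R0: "?R \<ge> 0" using \<open>B \<ge> 0\<close> by (simp add: sum_nonneg)
    have each: "(\<Sum>i\<in>I. rsign A i * h i u)\<^sup>2 \<le> ?R" if "u \<in> U" for u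
    proof -
      have "(\<Sum>i\<in>I. rsign A i * h i u) = (\<Sum>i\<in>I. rsign A i * (\<Sum>e\<in>E. q u e * h i e))"
        by (intro sum.cong refl) (simp only: hE[symmetric])
      also have "\<dots> = (\<Sum>e\<in>E. q u e * (\<Sum>i\<in>I. rsign A i * h i e))"
        unfolding sum_distrib_left by (subst sum.swap) (simp add: algebra_simps)
      finally have "(\<Sum>i\<in>I. rsign A i * h i u)\<^sup>2
          \<le> (\<Sum>e\<in>E. (q u e)\<^sup>2) * (\<Sum>e\<in>E. (\<Sum>i\<in>I. rsign A i * h i e)\<^sup>2)"
        by (simp only: Cauchy_Schwarz_ineq_sum)
      also have "\<dots> \<le> ?R" using qq[OF that] by (intro mult_right_mono) (simp_all add: sum_nonneg)
      finally show ?thesis .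
    qed
    have "(MAX u\<in>U. \<Sum>i\<in>I. rsign A i * h i u) \<in> (\<lambda>u. \<Sum>i\<in>I. rsign A i * h i u) ` U"
      using U by (intro Max_in) auto
    then obtain u where "u \<in> U" "(MAX u\<in>U. \<Sum>i\<in>I. rsign A i * h i u) = (\<Sum>i\<in>I. rsign A i * h i u)"
      by blast
    then show ?thesis using each[of u] R0 by (simp add: max_def)
  qed
  have "(\<Sum>A\<in>Pow I. (max 0 (MAX u\<in>U. \<Sum>i\<in>I. rsign A i * h i u))\<^sup>2)
      \<le> (\<Sum>A\<in>Pow I. B * (\<Sum>e\<in>E. (\<Sum>i\<in>I. rsign A i * h i e)\<^sup>2))"
    by (intro sum_mono pt)
  also have "\<dots> = B * (\<Sum>e\<in>E. \<Sum>A\<in>Pow I. (\<Sum>i\<in>I. rsign A i * h i e)\<^sup>2)"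
    unfolding sum_distrib_left[symmetric] by (subst sum.swap) simp
  also have "\<dots> = B * (\<Sum>e\<in>E. 2 ^ card I * q e e)"
    unfolding sum_Pow_rademacher_square[OF \<open>finite I\<close>] by (simp add: q_def power2_eq_square)
  also have "\<dots> = B * (2 ^ card I * card E)" using E(3) by simp
  also have "\<dots> \<le> B * (2 ^ card I * DIM('a))"
    using E(2) \<open>B \<ge> 0\<close> by (intro mult_left_mono) auto
  finally show ?thesis by (simp add: algebra_simps)
qed

section \<open>Symmetrization\<close>

lemma pos_part_Max_add_sq_le:
  fixes x y :: "'u \<Rightarrow> real"
  assumes "finite U" "U \<noteq> {}"
  shows "(max 0 (MAX u\<in>U. x u + y u))\<^sup>2
    \<le> 2 * (max 0 (MAX u\<in>U. x u))\<^sup>2 + 2 * (max 0 (MAX u\<in>U. y u))\<^sup>2"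
proof -
  define a b where "a = max 0 (MAX u\<in>U. x u)" and "b = max 0 (MAX u\<in>U. y u)"
  have ab: "x u \<le> a" "y u \<le> b" if "u \<in> U" for u
    using assms that unfolding a_def b_def by (auto intro!: max.coboundedI2 Max_ge)
  have "(MAX u\<in>U. x u + y u) \<le> a + b"
    using assms ab by (subst Max_le_iff) (auto intro: add_mono)
  then have "max 0 (MAX u\<in>U. x u + y u) \<le> a + b" by (simp add: a_def b_def)
  then have "(max 0 (MAX u\<in>U. x u + y u))\<^sup>2 \<le> (a + b)\<^sup>2" by (intro power_mono) auto
  also have "\<dots> \<le> 2 * a\<^sup>2 + 2 * b\<^sup>2"
    using sum_squares_ge_zero[of "a - b" 0] by (simp add: power2_eq_square algebra_simps)
  finally show ?thesis by (simp add: a_def b_def)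
qed

text \<open>
  Jensen's inequality for the convex function \<open>x \<mapsto> (max 0 (MAX u\<in>U. x u))\<^sup>2\<close>. The right side
  is an extended integral, as the \<open>X u\<close> may fail to be square integrable.
\<close>

lemma (in prob_space) pos_part_Max_expectation_sq_le:
  fixes X :: "'u \<Rightarrow> 'a \<Rightarrow> real"
  assumes U: "finite U" "U \<noteq> {}" and X: "\<And>u. u \<in> U \<Longrightarrow> integrable M (X u)"
  shows "ennreal ((max 0 (MAX u\<in>U. expectation (X u)))\<^sup>2)
           \<le> (\<integral>\<^sup>+ z. ennreal ((max 0 (MAX u\<in>U. X u z))\<^sup>2) \<partial>M)"
proof -
  define Y where "Y = (\<lambda>z. max 0 (MAX u\<in>U. X u z))"
  have [measurable]: "X u \<in> borel_measurable M" if "u \<in> U" for u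
    using X[OF that] by (rule borel_measurable_integrable)
  have Ym: "Y \<in> borel_measurable M"
    unfolding Y_def using U by (intro borel_measurable_max borel_measurable_const borel_measurable_Max) auto
  have Yb: "Y z \<le> (\<Sum>u\<in>U. \<bar>X u z\<bar>)" for z
  proof -
    have "X u z \<le> (\<Sum>u\<in>U. \<bar>X u z\<bar>)" if "u \<in> U" for u
      using U that member_le_sum[of u U "\<lambda>u. \<bar>X u z\<bar>"] by (meson abs_ge_self abs_ge_zero order.trans)
    then have "(MAX u\<in>U. X u z) \<le> (\<Sum>u\<in>U. \<bar>X u z\<bar>)"
      using U by (subst Max_le_iff) auto
    then show ?thesis unfolding Y_def by (simp add: sum_nonneg)
  qed
  have XY: "X u z \<le> Y z" if "u \<in> U" for u z
    unfolding Y_def using U that by (intro max.coboundedI2 Max_ge) auto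
  have Y0: "0 \<le> Y z" for z by (simp add: Y_def)
  have Yi: "integrable M Y"
  proof (rule Bochner_Integration.integrable_bound)
    show "integrable M (\<lambda>z. \<Sum>u\<in>U. \<bar>X u z\<bar>)" using X by auto
    show "AE z in M. norm (Y z) \<le> norm (\<Sum>u\<in>U. \<bar>X u z\<bar>)"
    proof (rule AE_I2)
      fix z show "norm (Y z) \<le> norm (\<Sum>u\<in>U. \<bar>X u z\<bar>)" using Yb[of z] Y0[of z] by simp
    qed
  qed (rule Ym)
  have EY0: "expectation Y \<ge> 0" using Y0 by (intro integral_nonneg_AE) auto
  have "(MAX u\<in>U. expectation (X u)) \<le> expectation Y"
    using U X XY by (subst Max_le_iff) (auto intro!: integral_mono Yi)
  then have "(max 0 (MAX u\<in>U. expectation (X u)))\<^sup>2 \<le> (expectation Y)\<^sup>2"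
    using EY0 by (intro power_mono) auto
  moreover have "ennreal ((expectation Y)\<^sup>2) \<le> (\<integral>\<^sup>+ z. ennreal ((Y z)\<^sup>2) \<partial>M)"
  proof (cases "integrable M (\<lambda>z. (Y z)\<^sup>2)")
    case True
    have "(expectation Y)\<^sup>2 \<le> expectation (\<lambda>z. (Y z)\<^sup>2)"
      using variance_eq[OF Yi True] variance_positive[of Y] by simp
    also have "ennreal (expectation (\<lambda>z. (Y z)\<^sup>2)) = (\<integral>\<^sup>+ z. ennreal ((Y z)\<^sup>2) \<partial>M)"
      using True by (intro nn_integral_eq_integral[symmetric]) auto
    finally show ?thesis by (simp add: ennreal_leI)
  next
    case False
    have "(\<lambda>z. (Y z)\<^sup>2) \<in> borel_measurable M" using Ym by (rule borel_measurable_power)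
    then have "\<not> (\<integral>\<^sup>+ z. ennreal ((Y z)\<^sup>2) \<partial>M) < \<infinity>"
      using False integrableI_nonneg[of "\<lambda>z. (Y z)\<^sup>2" M] by (metis AE_I2 zero_le_power2)
    then have "(\<integral>\<^sup>+ z. ennreal ((Y z)\<^sup>2) \<partial>M) = \<infinity>"
      by (metis infinity_ennreal_def top.not_eq_extremum)
    then show ?thesis by simp
  qed
  ultimately show ?thesis unfolding Y_def by (blast intro: order.trans ennreal_leI)
qed

lemma integrable_PiM_component:
  fixes f :: "'b \<Rightarrow> real"
  assumes "prob_space P" "k \<in> K" "integrable P f"
  shows "integrable (PiM K (\<lambda>_. P)) (\<lambda>\<omega>. f (\<omega> k))"
    and "(\<integral>\<omega>. f (\<omega> k) \<partial>PiM K (\<lambda>_. P)) = (\<integral>z. f z \<partial>P)"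
proof -
  have d: "distr (PiM K (\<lambda>_. P)) P (\<lambda>\<omega>. \<omega> k) = P"
    using distr_PiM_component[of K "\<lambda>_. P" k] assms by simp
  have m: "(\<lambda>\<omega>. \<omega> k) \<in> measurable (PiM K (\<lambda>_. P)) P"
    using assms(2) by (rule measurable_component_singleton)
  have "integrable (distr (PiM K (\<lambda>_. P)) P (\<lambda>\<omega>. \<omega> k)) f" unfolding d by fact
  then show "integrable (PiM K (\<lambda>_. P)) (\<lambda>\<omega>. f (\<omega> k))" by (rule integrable_distr[OF m])
  have "(\<integral>\<omega>. f (\<omega> k) \<partial>PiM K (\<lambda>_. P)) = (\<integral>z. f z \<partial>distr (PiM K (\<lambda>_. P)) P (\<lambda>\<omega>. \<omega> k))"
    using assms by (intro integral_distr[symmetric] m) auto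
  then show "(\<integral>\<omega>. f (\<omega> k) \<partial>PiM K (\<lambda>_. P)) = (\<integral>z. f z \<partial>P)" unfolding d .
qed

lemma nn_integral_PiM_component:
  assumes "prob_space P" "k \<in> K" "f \<in> borel_measurable P"
  shows "(\<integral>\<^sup>+\<omega>. f (\<omega> k) \<partial>PiM K (\<lambda>_. P)) = (\<integral>\<^sup>+z. f z \<partial>P)"
proof -
  have d: "distr (PiM K (\<lambda>_. P)) P (\<lambda>\<omega>. \<omega> k) = P"
    using distr_PiM_component[of K "\<lambda>_. P" k] assms by simp
  have m: "(\<lambda>\<omega>. \<omega> k) \<in> measurable (PiM K (\<lambda>_. P)) P"
    using assms(2) by (rule measurable_component_singleton)
  have "(\<integral>\<^sup>+\<omega>. f (\<omega> k) \<partial>PiM K (\<lambda>_. P)) = (\<integral>\<^sup>+z. f z \<partial>distr (PiM K (\<lambda>_. P)) P (\<lambda>\<omega>. \<omega> k))"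
    using assms by (intro nn_integral_distr[symmetric] m) auto
  then show ?thesis unfolding d .
qed

lemma nn_integral_PiM_reindex:
  assumes P: "prob_space P" and s: "inj_on s I" "s \<in> I \<rightarrow> K"
    and H: "H \<in> borel_measurable (PiM I (\<lambda>_. P))"
  shows "(\<integral>\<^sup>+\<omega>. H (\<lambda>i\<in>I. \<omega> (s i)) \<partial>PiM K (\<lambda>_. P)) = (\<integral>\<^sup>+z. H z \<partial>PiM I (\<lambda>_. P))"
proof -
  have d: "distr (PiM K (\<lambda>_. P)) (PiM I (\<lambda>_. P)) (\<lambda>\<omega>. \<lambda>i\<in>I. \<omega> (s i)) = PiM I (\<lambda>_. P)"
    using distr_PiM_reindex[of K "\<lambda>_. P" s I] P s by simp
  have m: "(\<lambda>\<omega>. \<lambda>i\<in>I. \<omega> (s i)) \<in> measurable (PiM K (\<lambda>_. P)) (PiM I (\<lambda>_. P))"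
    using s by (intro measurable_restrict measurable_component_singleton) auto
  show ?thesis
    using nn_integral_distr[OF m, of H] H unfolding d by simp
qed

text \<open>
  The expectations become averages over an independent copy of the sample, and Jensen's inequality moves
  that average outside. The two samples are indexed by one set \<open>UNIV \<times> I\<close>, with the original sample at
  \<open>True\<close> and the copy at \<open>False\<close>, so that exchanging them is a permutation of the indices.
\<close>

lemma ghost_sample:
  fixes f :: "'u \<Rightarrow> 'b \<Rightarrow> real" and I :: "'i set"
  assumes P: "prob_space P" and U: "finite U" "U \<noteq> {}" and "finite I"
    and f: "\<And>u. u \<in> U \<Longrightarrow> integrable P (f u)"
  shows "(\<integral>\<^sup>+ z. ennreal ((max 0 (MAX u\<in>U. \<Sum>i\<in>I. (\<integral>x. f u x \<partial>P) - f u (z i)))\<^sup>2) \<partial>PiM I (\<lambda>_. P))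
    \<le> (\<integral>\<^sup>+ \<omega>. ennreal ((max 0 (MAX u\<in>U. \<Sum>i\<in>I. f u (\<omega> (False, i)) - f u (\<omega> (True, i))))\<^sup>2)
          \<partial>PiM (UNIV \<times> I) (\<lambda>_. P))"
proof -
  interpret P: prob_space P by fact
  interpret product_sigma_finite "\<lambda>_ :: bool \<times> 'i. P"
    by (simp add: product_sigma_finite_def P.sigma_finite_measure_axioms)
  have [measurable]: "f u \<in> borel_measurable P" if "u \<in> U" for u
    using f[OF that] by (rule borel_measurable_integrable)
  let ?K0 = "{False} \<times> I" and ?K1 = "{True} \<times> I"
  define H where "H = (\<lambda>\<omega>. ennreal ((max 0 (MAX u\<in>U. \<Sum>i\<in>I. f u (\<omega> (False, i)) - f u (\<omega> (True, i))))\<^sup>2))"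
  define \<Phi> where "\<Phi> = (\<lambda>z :: 'i \<Rightarrow> 'b. ennreal ((max 0 (MAX u\<in>U. \<Sum>i\<in>I. (\<integral>x. f u x \<partial>P) - f u (z i)))\<^sup>2))"
  have K: "UNIV \<times> I = ?K1 \<union> ?K0" by auto
  have fcomp: "(\<lambda>\<omega>. f u (\<omega> k)) \<in> borel_measurable (PiM K (\<lambda>_. P))" if "u \<in> U" "k \<in> K"
    for u and k :: "'k" and K
    using that by (intro measurable_compose[OF measurable_component_singleton]) auto
  have Hm: "H \<in> borel_measurable (PiM (?K1 \<union> ?K0) (\<lambda>_. P))"
    unfolding H_def using U fcomp
    by (intro measurable_compose[OF _ measurable_ennreal] borel_measurable_power borel_measurable_max
        borel_measurable_const borel_measurable_Max borel_measurable_sum borel_measurable_diff) auto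
  have \<Phi>m: "\<Phi> \<in> borel_measurable (PiM I (\<lambda>_. P))"
    unfolding \<Phi>_def using U fcomp
    by (intro measurable_compose[OF _ measurable_ennreal] borel_measurable_power borel_measurable_max
        borel_measurable_const borel_measurable_Max borel_measurable_sum borel_measurable_diff) auto
  interpret K0: prob_space "PiM ?K0 (\<lambda>_. P)" by (intro prob_space_PiM P)
  have inner: "\<Phi> (\<lambda>i\<in>I. x (True, i)) \<le> (\<integral>\<^sup>+ y. H (merge ?K1 ?K0 (x, y)) \<partial>PiM ?K0 (\<lambda>_. P))" for x
  proof -
    define X where "X = (\<lambda>u y. \<Sum>i\<in>I. f u (y (False, i)) - f u (x (True, i)))"
    have comp: "integrable (PiM ?K0 (\<lambda>_. P)) (\<lambda>y. f u (y (False, i)))"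
      "K0.expectation (\<lambda>y. f u (y (False, i))) = (\<integral>x. f u x \<partial>P)" if "u \<in> U" "i \<in> I" for u i
      using integrable_PiM_component[OF P _ f[OF that(1)], of "(False, i)" ?K0] that by auto
    have Xi: "integrable (PiM ?K0 (\<lambda>_. P)) (X u)" if "u \<in> U" for u
      unfolding X_def using comp(1)[OF that] by auto
    have EX: "K0.expectation (X u) = (\<Sum>i\<in>I. (\<integral>x. f u x \<partial>P) - f u (x (True, i)))" if "u \<in> U" for u
    proof -
      have "K0.expectation (X u) = (\<Sum>i\<in>I. K0.expectation (\<lambda>y. f u (y (False, i)) - f u (x (True, i))))"
        unfolding X_def using comp(1)[OF that] by (intro Bochner_Integration.integral_sum) auto
      also have "\<dots> = (\<Sum>i\<in>I. (\<integral>x. f u x \<partial>P) - f u (x (True, i)))"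
        using comp[OF that] by (intro sum.cong refl) (simp add: K0.prob_space)
      finally show ?thesis .
    qed
    have "\<Phi> (\<lambda>i\<in>I. x (True, i)) = ennreal ((max 0 (MAX u\<in>U. K0.expectation (X u)))\<^sup>2)"
      unfolding \<Phi>_def by (simp add: EX cong: image_cong_simp)
    also have "\<dots> \<le> (\<integral>\<^sup>+ y. ennreal ((max 0 (MAX u\<in>U. X u y))\<^sup>2) \<partial>PiM ?K0 (\<lambda>_. P))"
      using U Xi by (rule K0.pos_part_Max_expectation_sq_le)
    also have "\<dots> = (\<integral>\<^sup>+ y. H (merge ?K1 ?K0 (x, y)) \<partial>PiM ?K0 (\<lambda>_. P))"
      unfolding H_def X_def by (simp add: merge_def)
    finally show ?thesis .
  qed
  have "(\<integral>\<^sup>+ z. \<Phi> z \<partial>PiM I (\<lambda>_. P)) = (\<integral>\<^sup>+ x. \<Phi> (\<lambda>i\<in>I. x (True, i)) \<partial>PiM ?K1 (\<lambda>_. P))"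
    by (intro nn_integral_PiM_reindex[OF P _ _ \<Phi>m, symmetric]) (auto simp: inj_on_def)
  also have "\<dots> \<le> (\<integral>\<^sup>+ x. \<integral>\<^sup>+ y. H (merge ?K1 ?K0 (x, y)) \<partial>PiM ?K0 (\<lambda>_. P) \<partial>PiM ?K1 (\<lambda>_. P))"
    by (intro nn_integral_mono inner)
  also have "\<dots> = (\<integral>\<^sup>+ \<omega>. H \<omega> \<partial>PiM (UNIV \<times> I) (\<lambda>_. P))"
    unfolding K using \<open>finite I\<close> Hm by (intro product_nn_integral_fold[symmetric]) auto
  finally show ?thesis unfolding \<Phi>_def H_def .
qed

text \<open>
  A factor \<open>-1\<close> at \<open>i\<close> is undone by exchanging the two observations with index \<open>i\<close>, which leaves the
  product measure invariant.
\<close>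

lemma swap_invariance:
  fixes f :: "'u \<Rightarrow> 'b \<Rightarrow> real" and I A :: "'i set"
  assumes P: "prob_space P" and U: "finite U" "U \<noteq> {}"
    and f: "\<And>u. u \<in> U \<Longrightarrow> f u \<in> borel_measurable P"
  shows "(\<integral>\<^sup>+ \<omega>. ennreal ((max 0 (MAX u\<in>U. \<Sum>i\<in>I. rsign A i * (f u (\<omega> (False, i)) - f u (\<omega> (True, i)))))\<^sup>2)
            \<partial>PiM (UNIV \<times> I) (\<lambda>_. P))
       = (\<integral>\<^sup>+ \<omega>. ennreal ((max 0 (MAX u\<in>U. \<Sum>i\<in>I. f u (\<omega> (False, i)) - f u (\<omega> (True, i))))\<^sup>2)
            \<partial>PiM (UNIV \<times> I) (\<lambda>_. P))"
proof -
  define s :: "bool \<times> 'i \<Rightarrow> bool \<times> 'i" where "s = (\<lambda>(b, i). (b = (i \<in> A), i))"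
  define H where "H = (\<lambda>\<omega>. ennreal ((max 0 (MAX u\<in>U. \<Sum>i\<in>I. f u (\<omega> (False, i)) - f u (\<omega> (True, i))))\<^sup>2))"
  have fcomp: "(\<lambda>\<omega>. f u (\<omega> k)) \<in> borel_measurable (PiM (UNIV \<times> I) (\<lambda>_. P))"
    if "u \<in> U" "k \<in> UNIV \<times> I" for u and k :: "bool \<times> 'i"
    using measurable_compose[OF measurable_component_singleton[OF that(2)] f[OF that(1)]] .
  have Hm: "H \<in> borel_measurable (PiM (UNIV \<times> I) (\<lambda>_. P))"
    unfolding H_def using U fcomp
    by (intro measurable_compose[OF _ measurable_ennreal] borel_measurable_power borel_measurable_max
        borel_measurable_const borel_measurable_Max borel_measurable_sum borel_measurable_diff) auto
  have eq: "(\<Sum>i\<in>I. f u ((\<lambda>k\<in>UNIV \<times> I. \<omega> (s k)) (False, i)) - f u ((\<lambda>k\<in>UNIV \<times> I. \<omega> (s k)) (True, i)))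
     = (\<Sum>i\<in>I. rsign A i * (f u (\<omega> (False, i)) - f u (\<omega> (True, i))))" for u \<omega>
    by (intro sum.cong) (auto simp: s_def rsign_def)
  have "inj_on s (UNIV \<times> I)" "s \<in> UNIV \<times> I \<rightarrow> UNIV \<times> I" by (auto simp: s_def inj_on_def)
  from nn_integral_PiM_reindex[OF P this Hm] show ?thesis
    unfolding H_def eq .
qed

text \<open>
  Averaging \<open>swap_invariance\<close> over all \<open>A\<close> yields a Rademacher process in the differences
  \<open>f u (\<omega> (False, i)) - f u (\<omega> (True, i))\<close>. It is split into two processes, one for each sample, because
  the contraction principle applies to \<open>f\<close> and to \<open>- f\<close> but not to such differences; hence the two values
  of \<open>\<tau>\<close>. The factor is \<open>4 = 2 * 2\<close>: two samples, and \<open>(x + y)\<^sup>2 \<le> 2 * x\<^sup>2 + 2 * y\<^sup>2\<close>.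
\<close>

lemma symmetrization_second_moment:
  fixes f :: "'u \<Rightarrow> 'b \<Rightarrow> real" and I :: "'i set" and V :: "'b \<Rightarrow> real"
  assumes P: "prob_space P" and U: "finite U" "U \<noteq> {}" and I: "finite I"
    and f: "\<And>u. u \<in> U \<Longrightarrow> integrable P (f u)"
    and V: "V \<in> borel_measurable P" "\<And>z. 0 \<le> V z"
    and R: "\<And>\<tau> z. \<tau> \<in> {1, -1} \<Longrightarrow>
      (\<Sum>A\<in>Pow I. (max 0 (MAX u\<in>U. \<Sum>i\<in>I. rsign A i * (\<tau> * f u (z i))))\<^sup>2) \<le> 2 ^ card I * (\<Sum>i\<in>I. V (z i))"
  shows "(\<integral>\<^sup>+ z. ennreal ((max 0 (MAX u\<in>U. \<Sum>i\<in>I. (\<integral>x. f u x \<partial>P) - f u (z i)))\<^sup>2) \<partial>PiM I (\<lambda>_. P))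
    \<le> ennreal (4 * card I) * (\<integral>\<^sup>+ x. ennreal (V x) \<partial>P)"
proof -
  let ?K = "(UNIV :: bool set) \<times> I"
  let ?\<Omega> = "PiM ?K (\<lambda>_. P)"
  define H where "H = (\<lambda>A \<omega>. (max 0 (MAX u\<in>U. \<Sum>i\<in>I. rsign A i * (f u (\<omega> (False, i)) - f u (\<omega> (True, i)))))\<^sup>2)"
  define J where "J = (\<integral>\<^sup>+ \<omega>. ennreal ((max 0 (MAX u\<in>U. \<Sum>i\<in>I. f u (\<omega> (False, i)) - f u (\<omega> (True, i))))\<^sup>2) \<partial>?\<Omega>)"
  have fm: "f u \<in> borel_measurable P" if "u \<in> U" for u
    using f[OF that] by (rule borel_measurable_integrable)
  have fcomp: "(\<lambda>\<omega>. f u (\<omega> k)) \<in> borel_measurable ?\<Omega>" if "u \<in> U" "k \<in> ?K" for u k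
    using measurable_compose[OF measurable_component_singleton[OF that(2)] fm[OF that(1)]] .
  have Vcomp: "(\<lambda>\<omega>. V (\<omega> k)) \<in> borel_measurable ?\<Omega>" if "k \<in> ?K" for k
    using measurable_compose[OF measurable_component_singleton[OF that] V(1)] .
  have Hm: "(\<lambda>\<omega>. ennreal (H A \<omega>)) \<in> borel_measurable ?\<Omega>" for A
    unfolding H_def using U fcomp
    by (intro measurable_compose[OF _ measurable_ennreal] borel_measurable_power borel_measurable_max
        borel_measurable_const borel_measurable_Max borel_measurable_sum borel_measurable_times
        borel_measurable_diff) auto
  have HJ: "(\<integral>\<^sup>+ \<omega>. ennreal (H A \<omega>) \<partial>?\<Omega>) = J" for A
    unfolding H_def J_def by (rule swap_invariance[OF P U]) (rule fm)
  define W where "W = (\<lambda>\<omega>. (\<Sum>i\<in>I. 2 * V (\<omega> (False, i)) + 2 * V (\<omega> (True, i))))"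
  have pt: "(\<Sum>A\<in>Pow I. H A \<omega>) \<le> 2 ^ card I * W \<omega>" for \<omega>
  proof -
    define x y where "x = (\<lambda>A u. \<Sum>i\<in>I. rsign A i * (1 * f u (\<omega> (False, i))))"
      and "y = (\<lambda>A u. \<Sum>i\<in>I. rsign A i * (- 1 * f u (\<omega> (True, i))))"
    have "(\<Sum>A\<in>Pow I. H A \<omega>) = (\<Sum>A\<in>Pow I. (max 0 (MAX u\<in>U. x A u + y A u))\<^sup>2)"
      unfolding H_def x_def y_def sum.distrib[symmetric] by (simp add: algebra_simps)
    also have "\<dots> \<le> (\<Sum>A\<in>Pow I. 2 * (max 0 (MAX u\<in>U. x A u))\<^sup>2 + 2 * (max 0 (MAX u\<in>U. y A u))\<^sup>2)"
      by (intro sum_mono pos_part_Max_add_sq_le U)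
    also have "\<dots> = 2 * (\<Sum>A\<in>Pow I. (max 0 (MAX u\<in>U. x A u))\<^sup>2) + 2 * (\<Sum>A\<in>Pow I. (max 0 (MAX u\<in>U. y A u))\<^sup>2)"
      by (simp add: sum.distrib sum_distrib_left)
    also have "\<dots> \<le> 2 * (2 ^ card I * (\<Sum>i\<in>I. V (\<omega> (False, i)))) + 2 * (2 ^ card I * (\<Sum>i\<in>I. V (\<omega> (True, i))))"
      unfolding x_def y_def
      using R[of 1 "\<lambda>i. \<omega> (False, i)"] R[of "- 1" "\<lambda>i. \<omega> (True, i)"] by (intro add_mono mult_left_mono) auto
    also have "\<dots> = 2 ^ card I * W \<omega>"
      unfolding W_def sum.distrib sum_distrib_left[symmetric] by (simp add: algebra_simps)
    finally show ?thesis .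
  qed
  have W: "(\<integral>\<^sup>+ \<omega>. ennreal (W \<omega>) \<partial>?\<Omega>) = ennreal (4 * card I) * (\<integral>\<^sup>+ x. ennreal (V x) \<partial>P)"
  proof -
    have comp: "(\<integral>\<^sup>+ \<omega>. ennreal (V (\<omega> k)) \<partial>?\<Omega>) = (\<integral>\<^sup>+ x. ennreal (V x) \<partial>P)" if "k \<in> ?K" for k
      using nn_integral_PiM_component[OF P that, of "\<lambda>x. ennreal (V x)"] V by simp
    have "(\<integral>\<^sup>+ \<omega>. ennreal (W \<omega>) \<partial>?\<Omega>)
      = (\<integral>\<^sup>+ \<omega>. (\<Sum>i\<in>I. 2 * ennreal (V (\<omega> (False, i))) + 2 * ennreal (V (\<omega> (True, i)))) \<partial>?\<Omega>)"
      unfolding W_def using V(2)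
      by (intro nn_integral_cong) (simp add: sum_ennreal[symmetric] ennreal_plus ennreal_mult del: sum_ennreal)
    also have "\<dots> = (\<Sum>i\<in>I. (\<integral>\<^sup>+ \<omega>. 2 * ennreal (V (\<omega> (False, i))) + 2 * ennreal (V (\<omega> (True, i))) \<partial>?\<Omega>))"
      using Vcomp by (intro nn_integral_sum) auto
    also have "\<dots> = (\<Sum>i\<in>I. 4 * (\<integral>\<^sup>+ x. ennreal (V x) \<partial>P))"
    proof (intro sum.cong refl)
      fix i assume i: "i \<in> I"
      then have m: "(\<lambda>\<omega>. ennreal (V (\<omega> (b, i)))) \<in> borel_measurable ?\<Omega>" for b using Vcomp by auto
      have "(\<integral>\<^sup>+ \<omega>. 2 * ennreal (V (\<omega> (False, i))) + 2 * ennreal (V (\<omega> (True, i))) \<partial>?\<Omega>)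
         = 2 * (\<integral>\<^sup>+ x. ennreal (V x) \<partial>P) + 2 * (\<integral>\<^sup>+ x. ennreal (V x) \<partial>P)"
        using m i by (subst nn_integral_add) (auto simp: nn_integral_cmult comp)
      then show "(\<integral>\<^sup>+ \<omega>. 2 * ennreal (V (\<omega> (False, i))) + 2 * ennreal (V (\<omega> (True, i))) \<partial>?\<Omega>)
         = 4 * (\<integral>\<^sup>+ x. ennreal (V x) \<partial>P)" by (simp add: distrib_right[symmetric])
    qed
    also have "\<dots> = ennreal (4 * card I) * (\<integral>\<^sup>+ x. ennreal (V x) \<partial>P)"
      by (simp add: ennreal_mult ennreal_of_nat_eq_real_of_nat ac_simps)
    finally show ?thesis .
  qed
  have "ennreal (2 ^ card I) * J = (\<Sum>A\<in>Pow I. (\<integral>\<^sup>+ \<omega>. ennreal (H A \<omega>) \<partial>?\<Omega>))"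
    unfolding HJ using I by (simp add: card_Pow ennreal_power[symmetric])
  also have "\<dots> = (\<integral>\<^sup>+ \<omega>. (\<Sum>A\<in>Pow I. ennreal (H A \<omega>)) \<partial>?\<Omega>)"
    by (intro nn_integral_sum[symmetric] Hm)
  also have "\<dots> = (\<integral>\<^sup>+ \<omega>. ennreal (\<Sum>A\<in>Pow I. H A \<omega>) \<partial>?\<Omega>)"
    by (intro nn_integral_cong sum_ennreal) (simp add: H_def)
  also have "\<dots> \<le> (\<integral>\<^sup>+ \<omega>. ennreal (2 ^ card I * W \<omega>) \<partial>?\<Omega>)"
    by (intro nn_integral_mono ennreal_leI pt)
  also have "\<dots> = ennreal (2 ^ card I) * (\<integral>\<^sup>+ \<omega>. ennreal (W \<omega>) \<partial>?\<Omega>)"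
  proof -
    have "W \<in> borel_measurable ?\<Omega>"
      unfolding W_def using Vcomp by (intro borel_measurable_sum borel_measurable_add borel_measurable_times) auto
    then show ?thesis by (subst nn_integral_cmult[symmetric]) (auto simp: ennreal_mult')
  qed
  finally have "J \<le> (\<integral>\<^sup>+ \<omega>. ennreal (W \<omega>) \<partial>?\<Omega>)"
    by (subst (asm) ennreal_mult_le_mult_iff) auto
  moreover have "(\<integral>\<^sup>+ z. ennreal ((max 0 (MAX u\<in>U. \<Sum>i\<in>I. (\<integral>x. f u x \<partial>P) - f u (z i)))\<^sup>2) \<partial>PiM I (\<lambda>_. P)) \<le> J"
    unfolding J_def by (rule ghost_sample[OF P U I f])
  ultimately show ?thesis unfolding W by (rule order.trans[rotated])
qed

section \<open>Powers of linear forms under an envelope\<close>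

text \<open>
  By the mean value theorem, as the derivative \<open>r * t powr (r - 1)\<close> is largest at the right end.
\<close>

lemma powr_diff_le:
  fixes x y K r :: real
  assumes "1 \<le> r" "0 \<le> x" "0 \<le> y" "x \<le> K" "y \<le> K"
  shows "\<bar>x powr r - y powr r\<bar> \<le> r * K powr (r - 1) * \<bar>x - y\<bar>"
proof -
  have main: "b powr r - a powr r \<le> r * K powr (r - 1) * (b - a)" if ab: "0 \<le> a" "a < b" "b \<le> K" for a b :: real
  proof -
    have "continuous_on {a..b} (\<lambda>t. t powr r)"
      using ab \<open>1 \<le> r\<close> by (intro continuous_on_powr' continuous_intros) auto
    moreover have D: "((\<lambda>t. t powr r) has_real_derivative r * t powr (r - 1)) (at t)" if "a < t" for t
      using has_real_derivative_powr[of t r] ab that by simp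
    moreover have "(\<lambda>t. t powr r) differentiable (at t)" if "a < t" for t
      using D[OF that] unfolding real_differentiable_def by blast
    ultimately obtain l t where t: "a < t" "t < b" "((\<lambda>t. t powr r) has_real_derivative l) (at t)"
        "b powr r - a powr r = (b - a) * l"
      using MVT[of a b "\<lambda>t. t powr r"] ab(2) by blast
    have "l = r * t powr (r - 1)" using DERIV_unique[OF t(3) D[OF t(1)]] .
    moreover have "t powr (r - 1) \<le> K powr (r - 1)"
      using t ab \<open>1 \<le> r\<close> by (intro powr_mono2) auto
    ultimately have "l \<le> r * K powr (r - 1)" using \<open>1 \<le> r\<close> by (simp add: mult_left_mono)
    then have "(b - a) * l \<le> (b - a) * (r * K powr (r - 1))" using ab by (intro mult_left_mono) auto
    then show ?thesis using t(4) by (simp add: mult.commute)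
  qed
  consider "x < y" | "y < x" | "x = y" by linarith
  then show ?thesis
  proof cases
    case 1
    then have "x powr r \<le> y powr r" using assms by (intro powr_mono2) auto
    then show ?thesis using main[of x y] 1 assms by simp
  next
    case 2
    then have "y powr r \<le> x powr r" using assms by (intro powr_mono2) auto
    then show ?thesis using main[of y x] 2 assms by simp
  qed simp
qed

lemma abs_powr_diff_le:
  fixes x y K r :: real
  assumes "1 \<le> r" "\<bar>x\<bar> \<le> K" "\<bar>y\<bar> \<le> K"
  shows "\<bar>\<bar>x\<bar> powr r - \<bar>y\<bar> powr r\<bar> \<le> r * K powr (r - 1) * \<bar>x - y\<bar>"
proof -
  have "\<bar>\<bar>x\<bar> powr r - \<bar>y\<bar> powr r\<bar> \<le> r * K powr (r - 1) * \<bar>\<bar>x\<bar> - \<bar>y\<bar>\<bar>"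
    using assms by (intro powr_diff_le) auto
  also have "\<dots> \<le> r * K powr (r - 1) * \<bar>x - y\<bar>"
    using assms by (intro mult_left_mono) auto
  finally show ?thesis .
qed

text \<open>
  The function \<open>t \<mapsto> \<bar>t\<bar> powr r\<close> vanishes at \<open>0\<close> and has Lipschitz constant \<open>r * D i powr (r - 1)\<close> on
  \<open>[- D i, D i]\<close>. So the process is a contraction of the linear one with
  \<open>h i u = r * D i powr (r - 1) * (x i \<bullet> u)\<close>, and \<open>\<bar>h i u\<bar> \<le> r * D i powr r\<close>.
\<close>

lemma rademacher_abs_powr_bound:
  fixes x :: "'i \<Rightarrow> 'a::euclidean_space" and D :: "'i \<Rightarrow> real" and \<tau> r :: real
  assumes "1 \<le> r" and U: "finite U" "U \<noteq> {}" and I: "finite I"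
    and D: "\<And>i u. i \<in> I \<Longrightarrow> u \<in> U \<Longrightarrow> \<bar>x i \<bullet> u\<bar> \<le> D i" and \<tau>: "\<tau> \<in> {1, -1}"
  shows "(\<Sum>A\<in>Pow I. (max 0 (MAX u\<in>U. \<Sum>i\<in>I. rsign A i * (\<tau> * \<bar>x i \<bullet> u\<bar> powr r)))\<^sup>2)
      \<le> 2 ^ card I * (\<Sum>i\<in>I. DIM('a) * (r\<^sup>2 * D i powr (2 * r)))"
proof -
  define g where "g = (\<lambda>i u. \<tau> * \<bar>x i \<bullet> u\<bar> powr r)"
  define h where "h = (\<lambda>i u. (r * D i powr (r - 1)) *\<^sub>R x i \<bullet> u)"
  define G where "G = (\<lambda>t::real. (max 0 t)\<^sup>2)"
  have cG: "convex_on UNIV G"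
  proof (rule convex_onI)
    fix t x y :: real assume t: "0 < t" "t < 1"
    have "(1 - t) * x \<le> (1 - t) * max 0 x" "t * y \<le> t * max 0 y" "0 \<le> (1 - t) * max 0 x" "0 \<le> t * max 0 y"
      using t by (intro mult_left_mono mult_nonneg_nonneg; simp)+
    then have "(max 0 ((1 - t) * x + t * y))\<^sup>2 \<le> ((1 - t) * max 0 x + t * max 0 y)\<^sup>2"
      by (intro power_mono) auto
    also have "\<dots> \<le> (1 - t) * (max 0 x)\<^sup>2 + t * (max 0 y)\<^sup>2"
      using convex_onD[OF convex_power2, of t "max 0 x" "max 0 y"] t by simp
    finally show "G ((1 - t) *\<^sub>R x + t *\<^sub>R y) \<le> (1 - t) * G x + t * G y" by (simp add: G_def)
  qed simp
  have mG: "mono G" unfolding G_def by (intro monoI power_mono) auto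
  have \<tau>1: "\<bar>\<tau>\<bar> = 1" using \<tau> by auto
  have lip: "\<bar>g i u - g i v\<bar> \<le> \<bar>h i u - h i v\<bar>" if "i \<in> I" "u \<in> U" "v \<in> U" for i u v
  proof -
    have "\<bar>g i u - g i v\<bar> = \<bar>\<tau>\<bar> * \<bar>\<bar>x i \<bullet> u\<bar> powr r - \<bar>x i \<bullet> v\<bar> powr r\<bar>"
      unfolding g_def abs_mult[symmetric] by (simp add: right_diff_distrib)
    also have "\<dots> \<le> r * D i powr (r - 1) * \<bar>x i \<bullet> u - x i \<bullet> v\<bar>"
      using abs_powr_diff_le[OF \<open>1 \<le> r\<close> D D] that \<tau>1 by simp
    also have "\<dots> = \<bar>h i u - h i v\<bar>"
      using \<open>1 \<le> r\<close> unfolding h_def inner_scaleR_left right_diff_distrib[symmetric] abs_mult by simp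
    finally show ?thesis .
  qed
  have bnd: "\<bar>g i u\<bar> \<le> \<bar>h i u\<bar>" if "i \<in> I" "u \<in> U" for i u
  proof -
    have "0 \<le> D i" using D[OF that] by linarith
    have "\<bar>g i u\<bar> = \<bar>\<bar>x i \<bullet> u\<bar> powr r - \<bar>0\<bar> powr r\<bar>"
      unfolding g_def abs_mult \<tau>1 by simp
    also have "\<dots> \<le> r * D i powr (r - 1) * \<bar>x i \<bullet> u - 0\<bar>"
      using D[OF that] \<open>0 \<le> D i\<close> by (intro abs_powr_diff_le \<open>1 \<le> r\<close>) auto
    also have "\<dots> = \<bar>h i u\<bar>"
      using \<open>1 \<le> r\<close> unfolding h_def inner_scaleR_left abs_mult by simp
    finally show ?thesis .
  qed
  have sq: "(h i u)\<^sup>2 \<le> r\<^sup>2 * D i powr (2 * r)" if "i \<in> I" "u \<in> U" for i u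
  proof -
    have D0: "0 \<le> D i" using D[OF that] by linarith
    have "\<bar>h i u\<bar> \<le> r * (D i powr (r - 1) * D i)"
      using D[OF that] \<open>1 \<le> r\<close> unfolding h_def inner_scaleR_left abs_mult
      by (simp add: mult.assoc mult_left_mono)
    also have "D i powr (r - 1) * D i = D i powr r"
      using D0 by (cases "D i = 0") (auto simp: powr_diff)
    finally have "\<bar>h i u\<bar>\<^sup>2 \<le> (r * D i powr r)\<^sup>2" by (intro power_mono) auto
    also have "\<dots> = r\<^sup>2 * D i powr (2 * r)"
      by (simp add: power_mult_distrib power2_eq_square powr_add[symmetric])
    finally show ?thesis by simp
  qed
  have "(\<Sum>A\<in>Pow I. G (MAX u\<in>U. 0 + (\<Sum>i\<in>I. rsign A i * g i u)))
      \<le> (\<Sum>A\<in>Pow I. G (MAX u\<in>U. 0 + (\<Sum>i\<in>I. rsign A i * h i u)))"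
    by (rule rademacher_contraction[OF cG mG U I bnd lip])
  also have "\<dots> \<le> 2 ^ card I * (DIM('a) * (\<Sum>i\<in>I. r\<^sup>2 * D i powr (2 * r)))"
    unfolding G_def add_0
  proof (rule linear_rademacher_bound[OF _ I U])
    show "linear (h i)" for i unfolding h_def by (intro bounded_linear.linear bounded_linear_inner_right)
    show "(\<Sum>i\<in>I. (h i u)\<^sup>2) \<le> (\<Sum>i\<in>I. r\<^sup>2 * D i powr (2 * r))" if "u \<in> U" for u
      using sq that by (intro sum_mono) auto
  qed
  finally show ?thesis unfolding G_def g_def add_0 by (simp add: sum_distrib_left)
qed

lemma second_moment_abs_powr:
  fixes w :: "'b \<Rightarrow> 'a::euclidean_space" and D :: "'b \<Rightarrow> real" and I :: "'i set"
  assumes P: "prob_space P" and "1 \<le> r" and U: "finite U" "U \<noteq> {}" and I: "finite I"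
    and w: "w \<in> borel_measurable P" and Dm: "D \<in> borel_measurable P"
    and D: "\<And>z u. u \<in> U \<Longrightarrow> \<bar>w z \<bullet> u\<bar> \<le> D z"
    and fi: "\<And>u. u \<in> U \<Longrightarrow> integrable P (\<lambda>x. \<bar>w x \<bullet> u\<bar> powr r)"
  shows "(\<integral>\<^sup>+ z. ennreal ((max 0 (MAX u\<in>U. \<Sum>i\<in>I. (\<integral>x. \<bar>w x \<bullet> u\<bar> powr r \<partial>P) - \<bar>w (z i) \<bullet> u\<bar> powr r))\<^sup>2)
            \<partial>PiM I (\<lambda>_. P))
    \<le> ennreal (4 * card I) * (\<integral>\<^sup>+ x. ennreal (DIM('a) * (r\<^sup>2 * D x powr (2 * r))) \<partial>P)"
proof (rule symmetrization_second_moment[OF P U I])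
  show "(\<lambda>x. DIM('a) * (r\<^sup>2 * D x powr (2 * r))) \<in> borel_measurable P" using Dm by measurable
  show "(\<Sum>A\<in>Pow I. (max 0 (MAX u\<in>U. \<Sum>i\<in>I. rsign A i * (\<tau> * \<bar>w (z i) \<bullet> u\<bar> powr r)))\<^sup>2)
       \<le> 2 ^ card I * (\<Sum>i\<in>I. DIM('a) * (r\<^sup>2 * D (z i) powr (2 * r)))" if "\<tau> \<in> {1, -1}" for \<tau> z
    using rademacher_abs_powr_bound[OF \<open>1 \<le> r\<close> U I, of "\<lambda>i. w (z i)" "\<lambda>i. D (z i)"] D that by blast
qed (use fi in auto)

lemma integrable_abs_powr_envelope:
  fixes g D :: "'b \<Rightarrow> real" and r :: real
  assumes P: "prob_space P" and "1 \<le> r" and g: "g \<in> borel_measurable P" and Dm: "D \<in> borel_measurable P"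
    and gD: "\<And>z. \<bar>g z\<bar> \<le> D z"
    and fin: "(\<integral>\<^sup>+ z. ennreal (D z powr (2 * r)) \<partial>P) < \<infinity>"
  shows "integrable P (\<lambda>z. \<bar>g z\<bar> powr r)"
proof (rule Bochner_Integration.integrable_bound)
  interpret prob_space P by fact
  have "integrable P (\<lambda>z. D z powr (2 * r))"
    using Dm fin by (intro integrableI_nonneg) auto
  then show "integrable P (\<lambda>z. 1 + D z powr (2 * r))" by simp
  show "(\<lambda>z. \<bar>g z\<bar> powr r) \<in> borel_measurable P" using g by measurable
  show "AE z in P. norm (\<bar>g z\<bar> powr r) \<le> norm (1 + D z powr (2 * r))"
  proof (rule AE_I2)
    fix z
    have D0: "0 \<le> D z" using gD[of z] by linarith
    have "\<bar>g z\<bar> powr r \<le> D z powr r" using gD \<open>1 \<le> r\<close> by (intro powr_mono2) auto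
    also have "\<dots> \<le> 1 + D z powr (2 * r)"
    proof -
      have "D z powr (2 * r) = (D z powr r)\<^sup>2" by (simp add: power2_eq_square powr_add[symmetric])
      moreover have "x \<le> 1 + x\<^sup>2" for x :: real
      proof -
        have "2 * x \<le> 1 + x\<^sup>2" using zero_le_power2[of "x - 1"] by (simp add: power2_eq_square algebra_simps)
        then show ?thesis using zero_le_power2[of x] by linarith
      qed
      ultimately show ?thesis by simp
    qed
    finally show "norm (\<bar>g z\<bar> powr r) \<le> norm (1 + D z powr (2 * r))" by simp
  qed
qed

text \<open>
  Markov's inequality for the squared positive part, over an increasing sequence of finite subsets of \<open>U\<close>;
  \<open>K\<close> must not depend on the subset.
\<close>

lemma Markov_sup_countable:
  fixes X :: "'u \<Rightarrow> 'a \<Rightarrow> real"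
  assumes U: "countable U" and T: "0 < T" and X: "\<And>u. u \<in> U \<Longrightarrow> X u \<in> borel_measurable N"
    and K: "\<And>V. finite V \<Longrightarrow> V \<noteq> {} \<Longrightarrow> V \<subseteq> U \<Longrightarrow>
       (\<integral>\<^sup>+ z. ennreal ((max 0 (MAX u\<in>V. X u z))\<^sup>2) \<partial>N) \<le> ennreal K"
    and "0 \<le> K"
  shows "emeasure N {z \<in> space N. \<exists>u\<in>U. T < X u z} \<le> ennreal (K / T\<^sup>2)"
proof (cases "U = {}")
  case False
  define A where "A = (\<lambda>k. {z \<in> space N. \<exists>u\<in>from_nat_into U ` {..k::nat}. T < X u z})"
  have sub: "from_nat_into U ` {..k} \<subseteq> U" for k using from_nat_into[OF False] by auto
  have meas: "{z \<in> space N. \<exists>u\<in>V. T < X u z} \<in> sets N" if "finite V" "V \<subseteq> U" for V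
    using that by (induction V rule: finite_induct)
      (auto intro!: sets.sets_Collect_disj borel_measurable_less X)
  have A: "A k \<in> sets N" for k unfolding A_def by (rule meas) (use sub in auto)
  have Ab: "emeasure N (A k) \<le> ennreal (K / T\<^sup>2)" for k
  proof -
    let ?V = "from_nat_into U ` {..k}"
    define Y where "Y = (\<lambda>z. ennreal ((max 0 (MAX u\<in>?V. X u z))\<^sup>2))"
    have Ym: "Y \<in> borel_measurable N"
      unfolding Y_def using X sub
      by (intro measurable_compose[OF _ measurable_ennreal] borel_measurable_power borel_measurable_max
        borel_measurable_const borel_measurable_Max) blast+
    have "A k \<subseteq> {z \<in> space N. 1 \<le> ennreal (1 / T\<^sup>2) * Y z}"
    proof
      fix z assume "z \<in> A k"
      then obtain u where z: "z \<in> space N" and u: "u \<in> ?V" "T < X u z" unfolding A_def by blast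
      have "X u z \<le> (MAX u\<in>?V. X u z)" using u(1) by (intro Max_ge) auto
      then have "T\<^sup>2 \<le> (max 0 (MAX u\<in>?V. X u z))\<^sup>2" using u(2) T by (intro power_mono) auto
      then have "1 \<le> (1 / T\<^sup>2) * (max 0 (MAX u\<in>?V. X u z))\<^sup>2" using T by (simp add: field_simps)
      then have "ennreal 1 \<le> ennreal ((1 / T\<^sup>2) * (max 0 (MAX u\<in>?V. X u z))\<^sup>2)" by (rule ennreal_leI)
      moreover have "ennreal (1 / T\<^sup>2) * Y z = ennreal ((1 / T\<^sup>2) * (max 0 (MAX u\<in>?V. X u z))\<^sup>2)"
        unfolding Y_def by (rule ennreal_mult[symmetric]) auto
      ultimately have "1 \<le> ennreal (1 / T\<^sup>2) * Y z" by (simp only: ennreal_1)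
      then show "z \<in> {z \<in> space N. 1 \<le> ennreal (1 / T\<^sup>2) * Y z}" using z by blast
    qed
    then have "emeasure N (A k) \<le> emeasure N {z \<in> space N. 1 \<le> ennreal (1 / T\<^sup>2) * Y z}"
      using Ym by (intro emeasure_mono) auto
    also have "\<dots> \<le> ennreal (1 / T\<^sup>2) * (\<integral>\<^sup>+ z. Y z * indicator (space N) z \<partial>N)"
      using Ym by (intro nn_integral_Markov_inequality) auto
    also have "(\<integral>\<^sup>+ z. Y z * indicator (space N) z \<partial>N) = (\<integral>\<^sup>+ z. Y z \<partial>N)"
      by (intro nn_integral_cong) simp
    also have "ennreal (1 / T\<^sup>2) * (\<integral>\<^sup>+ z. Y z \<partial>N) \<le> ennreal (1 / T\<^sup>2) * ennreal K"
      unfolding Y_def using sub by (intro mult_left_mono K) auto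
    also have "\<dots> = ennreal (K / T\<^sup>2)" using T \<open>0 \<le> K\<close> by (simp add: ennreal_mult[symmetric])
    finally show ?thesis .
  qed
  have "{z \<in> space N. \<exists>u\<in>U. T < X u z} = (\<Union>k. A k)"
  proof (intro set_eqI iffI)
    fix z assume "z \<in> {z \<in> space N. \<exists>u\<in>U. T < X u z}"
    then obtain u where z: "z \<in> space N" and u: "u \<in> U" "T < X u z" by auto
    obtain k where "from_nat_into U k = u" using from_nat_into_surj[OF U u(1)] by blast
    then have "u \<in> from_nat_into U ` {..k}" by auto
    then have "z \<in> A k" unfolding A_def using z u(2) by auto
    then show "z \<in> (\<Union>k. A k)" by auto
  next
    fix z assume "z \<in> (\<Union>k. A k)"
    then obtain k where "z \<in> A k" by auto
    then show "z \<in> {z \<in> space N. \<exists>u\<in>U. T < X u z}" using sub[of k] unfolding A_def by auto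
  qed
  moreover have "emeasure N (\<Union>k. A k) = (SUP k. emeasure N (A k))"
  proof (rule SUP_emeasure_incseq[symmetric])
    show "range A \<subseteq> sets N" using A by auto
    have "A i \<subseteq> A j" if "i \<le> j" for i j
      using image_mono[of "{..i}" "{..j}" "from_nat_into U"] that unfolding A_def by auto
    then show "incseq A" by (simp add: incseq_def)
  qed
  ultimately show ?thesis using Ab by (simp add: SUP_least)
qed simp

lemma uniform_lower_deviation:
  fixes w :: "'b \<Rightarrow> 'a::euclidean_space" and D :: "'b \<Rightarrow> real" and I :: "'i set" and r \<kappa> T :: real
  assumes P: "prob_space P" and "1 \<le> r" and U: "countable U" and I: "finite I"
    and w: "w \<in> borel_measurable P" and Dm: "D \<in> borel_measurable P"
    and D: "\<And>z u. u \<in> U \<Longrightarrow> \<bar>w z \<bullet> u\<bar> \<le> D z"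
    and \<kappa>: "0 \<le> \<kappa>" "(\<integral>\<^sup>+ z. ennreal (D z powr (2 * r)) \<partial>P) \<le> ennreal \<kappa>"
    and T: "0 < T"
  shows "emeasure (PiM I (\<lambda>_. P)) {z \<in> space (PiM I (\<lambda>_. P)).
            \<exists>u\<in>U. T < (\<Sum>i\<in>I. (\<integral>x. \<bar>w x \<bullet> u\<bar> powr r \<partial>P) - \<bar>w (z i) \<bullet> u\<bar> powr r)}
       \<le> ennreal (4 * card I * (DIM('a) * (r\<^sup>2 * \<kappa>)) / T\<^sup>2)"
proof (rule Markov_sup_countable[OF U T])
  have wm: "(\<lambda>x. w x \<bullet> u) \<in> borel_measurable P" for u using w by measurable
  have fi: "integrable P (\<lambda>x. \<bar>w x \<bullet> u\<bar> powr r)" if "u \<in> U" for u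
  proof (rule integrable_abs_powr_envelope[where D = D and g = "\<lambda>x. w x \<bullet> u"])
    show "(\<integral>\<^sup>+ z. ennreal (D z powr (2 * r)) \<partial>P) < \<infinity>"
      using \<kappa>(2) by (rule le_less_trans) simp
  qed (use P \<open>1 \<le> r\<close> wm Dm D[OF that] in auto)
  show "(\<lambda>z. \<Sum>i\<in>I. (\<integral>x. \<bar>w x \<bullet> u\<bar> powr r \<partial>P) - \<bar>w (z i) \<bullet> u\<bar> powr r) \<in> borel_measurable (PiM I (\<lambda>_. P))" for u
  proof (intro borel_measurable_sum borel_measurable_diff borel_measurable_const)
    fix i assume i: "i \<in> I"
    have "(\<lambda>x. \<bar>w x \<bullet> u\<bar> powr r) \<in> borel_measurable P" using wm[of u] by measurable
    then show "(\<lambda>z. \<bar>w (z i) \<bullet> u\<bar> powr r) \<in> borel_measurable (PiM I (\<lambda>_. P))"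
      by (rule measurable_compose[OF measurable_component_singleton[OF i]])
  qed
  show "0 \<le> 4 * card I * (DIM('a) * (r\<^sup>2 * \<kappa>))" using \<kappa> by simp
  fix V assume V: "finite V" "V \<noteq> {}" "V \<subseteq> U"
  have "(\<integral>\<^sup>+ z. ennreal ((max 0 (MAX u\<in>V. \<Sum>i\<in>I. (\<integral>x. \<bar>w x \<bullet> u\<bar> powr r \<partial>P) - \<bar>w (z i) \<bullet> u\<bar> powr r))\<^sup>2) \<partial>PiM I (\<lambda>_. P))
    \<le> ennreal (4 * card I) * (\<integral>\<^sup>+ x. ennreal (DIM('a) * (r\<^sup>2 * D x powr (2 * r))) \<partial>P)"
    using V D fi by (intro second_moment_abs_powr[OF P \<open>1 \<le> r\<close> V(1,2) I w Dm]) auto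
  also have "(\<integral>\<^sup>+ x. ennreal (DIM('a) * (r\<^sup>2 * D x powr (2 * r))) \<partial>P)
      = (\<integral>\<^sup>+ x. ennreal (DIM('a) * r\<^sup>2) * ennreal (D x powr (2 * r)) \<partial>P)"
    by (intro nn_integral_cong) (simp add: ennreal_mult[symmetric] mult.assoc)
  also have "\<dots> = ennreal (DIM('a) * r\<^sup>2) * (\<integral>\<^sup>+ x. ennreal (D x powr (2 * r)) \<partial>P)"
    using Dm by (intro nn_integral_cmult) measurable
  also have "ennreal (4 * card I) * \<dots> \<le> ennreal (4 * card I) * (ennreal (DIM('a) * r\<^sup>2) * ennreal \<kappa>)"
    by (intro mult_left_mono \<kappa>(2)) auto
  also have "\<dots> = ennreal (4 * card I * (DIM('a) * (r\<^sup>2 * \<kappa>)))"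
    using \<kappa>(1) by (simp add: ennreal_mult[symmetric] mult.assoc)
  finally show "(\<integral>\<^sup>+ z. ennreal ((max 0 (MAX u\<in>V. \<Sum>i\<in>I. (\<integral>x. \<bar>w x \<bullet> u\<bar> powr r \<partial>P) - \<bar>w (z i) \<bullet> u\<bar> powr r))\<^sup>2) \<partial>PiM I (\<lambda>_. P))
    \<le> ennreal (4 * card I * (DIM('a) * (r\<^sup>2 * \<kappa>)))" .
qed

section \<open>Norms and their duals\<close>

lemma is_normD:
  assumes "is_norm N"
  shows "N v = 0 \<longleftrightarrow> v = 0" and "N (c *\<^sub>R v) = \<bar>c\<bar> * N v" and "N (v + w) \<le> N v + N w"
  using assms unfolding is_norm_def by blast+

lemma is_norm_nonneg: "is_norm N \<Longrightarrow> 0 \<le> N v"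
proof -
  assume N: "is_norm N"
  have "N (v + - 1 *\<^sub>R v) \<le> N v + \<bar>- 1\<bar> * N v" using N unfolding is_norm_def by metis
  moreover have "N (v + - 1 *\<^sub>R v) = 0" using N by (simp add: is_norm_def)
  ultimately show ?thesis by simp
qed

lemma is_norm_continuous:
  fixes N :: "'a::euclidean_space \<Rightarrow> real"
  assumes "is_norm N" shows "continuous_on UNIV N"
proof (rule convex_on_continuous)
  show "convex_on UNIV N"
  proof (rule convex_onI)
    fix t :: real and x y :: 'a assume t: "0 < t" "t < 1"
    have "N ((1 - t) *\<^sub>R x + t *\<^sub>R y) \<le> N ((1 - t) *\<^sub>R x) + N (t *\<^sub>R y)"
      by (rule is_normD(3)[OF assms])
    also have "\<dots> = (1 - t) * N x + t * N y" using t by (simp add: is_normD(2)[OF assms])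
    finally show "N ((1 - t) *\<^sub>R x + t *\<^sub>R y) \<le> (1 - t) * N x + t * N y" .
  qed simp
qed simp

lemma is_norm_lower_bound:
  fixes N :: "'a::euclidean_space \<Rightarrow> real"
  assumes N: "is_norm N"
  shows "\<exists>c>0. \<forall>v. c * norm v \<le> N v"
proof -
  have "sphere 0 1 \<noteq> ({} :: 'a set)"
    using SOME_Basis by (metis dist_0_norm empty_iff mem_sphere norm_Basis)
  then obtain x :: 'a where x: "x \<in> sphere 0 1" "\<And>y. y \<in> sphere 0 1 \<Longrightarrow> N x \<le> N y"
    using continuous_attains_inf[OF compact_sphere, of 0 1 N]
      continuous_on_subset[OF is_norm_continuous[OF N]] by (metis subset_UNIV)
  have "x \<noteq> 0" using x(1) by auto
  then have "N x > 0" using N is_norm_nonneg[OF N, of x] by (simp add: is_norm_def order_less_le)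
  moreover have "N x * norm v \<le> N v" for v
  proof (cases "v = 0")
    case True
    then show ?thesis using is_norm_nonneg[OF N] by simp
  next
    case False
    have "N x \<le> N (v /\<^sub>R norm v)" using False by (intro x(2)) simp
    also have "\<dots> = N v / norm v" using N by (simp add: is_norm_def divide_inverse mult.commute)
    finally show ?thesis using False by (simp add: field_simps)
  qed
  ultimately show ?thesis by blast
qed

text \<open>
  The supremum in \<open>dual_norm\<close> is over a bounded set of reals, because \<open>N\<close> dominates a multiple of the
  Euclidean norm; otherwise its value would be unspecified.
\<close>

lemma bdd_above_dual_norm:
  fixes N :: "'a::euclidean_space \<Rightarrow> real"
  assumes N: "is_norm N"
  shows "bdd_above ((\<lambda>y. x \<bullet> y) ` {y. N y = 1})"
proof -
  obtain c where c: "c > 0" "\<And>v. c * norm v \<le> N v" using is_norm_lower_bound[OF N] by blast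
  have "x \<bullet> y \<le> norm x * (1 / c)" if "N y = 1" for y
  proof -
    have "x \<bullet> y \<le> norm x * norm y" by (rule norm_cauchy_schwarz)
    also have "\<dots> \<le> norm x * (1 / c)"
      using c(2)[of y] c(1) that by (intro mult_left_mono) (auto simp: field_simps)
    finally show ?thesis .
  qed
  then show ?thesis by (auto intro!: bdd_aboveI)
qed

lemma inner_le_dual_norm:
  fixes N :: "'a::euclidean_space \<Rightarrow> real"
  assumes N: "is_norm N"
  shows "\<bar>x \<bullet> u\<bar> \<le> dual_norm N x * N u"
proof -
  have le: "x \<bullet> u \<le> dual_norm N x * N u" for u
  proof (cases "u = 0")
    case True
    then have "N u = 0" by (simp add: is_normD(1)[OF N])
    then show ?thesis using True by simp
  next
    case False
    then have pos: "N u > 0" using N is_norm_nonneg[OF N, of u] by (simp add: is_norm_def order_less_le)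
    have "N ((1 / N u) *\<^sub>R u) = \<bar>1 / N u\<bar> * N u" using N unfolding is_norm_def by blast
    then have "N ((1 / N u) *\<^sub>R u) = 1" using pos by simp
    then have "x \<bullet> ((1 / N u) *\<^sub>R u) \<le> dual_norm N x"
      unfolding dual_norm_def by (intro cSUP_upper bdd_above_dual_norm[OF N]) simp
    then show ?thesis using pos by (simp add: field_simps)
  qed
  have "N (- u) = N u"
    using N unfolding is_norm_def by (metis abs_minus_cancel abs_one mult_1 scaleR_minus1_left)
  then show ?thesis using le[of u] le[of "- u"] by (simp add: abs_le_iff)
qed

lemma ex_is_norm_unit:
  fixes N :: "'a::euclidean_space \<Rightarrow> real"
  assumes N: "is_norm N"
  shows "{y. N y = 1} \<noteq> {}"
proof -
  obtain b :: 'a where "b \<noteq> 0" using SOME_Basis nonzero_Basis by blast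
  then have pos: "N b > 0" using N is_norm_nonneg[OF N, of b] by (simp add: is_norm_def order_less_le)
  have "N ((1 / N b) *\<^sub>R b) = \<bar>1 / N b\<bar> * N b" using N unfolding is_norm_def by blast
  then have "N ((1 / N b) *\<^sub>R b) = 1" using pos by simp
  then show ?thesis by blast
qed

lemma dual_norm_nonneg:
  fixes N :: "'a::euclidean_space \<Rightarrow> real"
  assumes N: "is_norm N"
  shows "0 \<le> dual_norm N x"
proof -
  obtain y where "N y = 1" using ex_is_norm_unit[OF N] by blast
  then show ?thesis using inner_le_dual_norm[OF N, of x y] by simp
qed

text \<open>
  A supremum of linear functions is convex, and a finite convex function is continuous.
\<close>

lemma dual_norm_measurable:
  fixes N :: "'a::euclidean_space \<Rightarrow> real"
  assumes N: "is_norm N"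
  shows "dual_norm N \<in> borel_measurable borel"
proof -
  have "convex_on UNIV (dual_norm N)"
  proof (rule convex_onI)
    fix t :: real and x y :: 'a assume t: "0 < t" "t < 1"
    have "((1 - t) *\<^sub>R x + t *\<^sub>R y) \<bullet> z \<le> (1 - t) * dual_norm N x + t * dual_norm N y"
      if "N z = 1" for z
    proof -
      have "x \<bullet> z \<le> dual_norm N x" "y \<bullet> z \<le> dual_norm N y"
        using inner_le_dual_norm[OF N, of x z] inner_le_dual_norm[OF N, of y z] that by auto
      then show ?thesis using t unfolding inner_add_left inner_scaleR_left
        by (intro add_mono mult_left_mono) auto
    qed
    then show "dual_norm N ((1 - t) *\<^sub>R x + t *\<^sub>R y) \<le> (1 - t) * dual_norm N x + t * dual_norm N y"
      unfolding dual_norm_def[of N "(1 - t) *\<^sub>R x + t *\<^sub>R y"]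
      using ex_is_norm_unit[OF N] by (intro cSUP_least) auto
  qed simp
  then have "continuous_on UNIV (dual_norm N)" by (intro convex_on_continuous) auto
  then show ?thesis by (rule borel_measurable_continuous_onI)
qed

text \<open>
  Convexity and \<open>\<rho> 0 = 0\<close> give \<open>\<rho> (\<beta> / \<sigma>) \<le> \<rho> \<beta> / \<sigma>\<close>; apply the hypothesis on \<open>N\<close> at \<open>\<beta> / \<sigma>\<close> and
  multiply by \<open>\<sigma>\<close>.
\<close>

lemma penalty_dominates_scaled_norm:
  fixes N :: "(real^'d) \<times> real \<Rightarrow> real"
  assumes \<rho>: "convex_penalty \<rho>" and N: "is_norm N" and c: "\<And>\<gamma>. c * N (\<gamma>, -1) \<le> \<rho> \<gamma> + 1"
    and \<sigma>: "1 \<le> \<sigma>"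
  shows "c * N (\<beta>, - \<sigma>) \<le> \<sigma> + \<rho> \<beta>"
proof -
  have "\<rho> ((1 - 1 / \<sigma>) *\<^sub>R 0 + (1 / \<sigma>) *\<^sub>R \<beta>) \<le> (1 - 1 / \<sigma>) * \<rho> 0 + (1 / \<sigma>) * \<rho> \<beta>"
    using \<rho> \<sigma> by (intro convex_onD[of UNIV]) (auto simp: convex_penalty_def)
  then have "\<rho> ((1 / \<sigma>) *\<^sub>R \<beta>) \<le> \<rho> \<beta> / \<sigma>" using \<rho> by (simp add: convex_penalty_def)
  then have "c * N ((1 / \<sigma>) *\<^sub>R \<beta>, -1) \<le> \<rho> \<beta> / \<sigma> + 1" using c[of "(1 / \<sigma>) *\<^sub>R \<beta>"] by linarith
  then have "\<sigma> * (c * N ((1 / \<sigma>) *\<^sub>R \<beta>, -1)) \<le> \<sigma> * (\<rho> \<beta> / \<sigma> + 1)" using \<sigma> by (intro mult_left_mono) auto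
  moreover have "N (\<beta>, - \<sigma>) = \<sigma> * N ((1 / \<sigma>) *\<^sub>R \<beta>, -1)"
    using is_normD(2)[OF N, of \<sigma> "((1 / \<sigma>) *\<^sub>R \<beta>, -1)"] \<sigma> by simp
  ultimately show ?thesis using \<sigma> by (simp add: algebra_simps)
qed

section \<open>Moments of order p\<close>

lemma powr_convex_combination_le:
  fixes x y t p :: real
  assumes "1 \<le> p" "0 \<le> x" "0 \<le> y" "0 \<le> t" "t \<le> 1"
  shows "((1 - t) * x + t * y) powr p \<le> (1 - t) * x powr p + t * y powr p"
proof -
  have scale: "(c * y) powr p \<le> c * y powr p" if "0 \<le> c" "c \<le> 1" "0 \<le> y" for c y :: real
  proof -
    have "c powr p \<le> c"
      using that \<open>1 \<le> p\<close> powr_mono'[of 1 p c] by (cases "c = 0") auto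
    then show ?thesis using that by (simp add: powr_mult mult_right_mono)
  qed
  consider "x = 0" | "y = 0" | "x > 0" "y > 0" using assms by linarith
  then show ?thesis
  proof cases
    case 1
    then show ?thesis using scale[of t y] assms by simp
  next
    case 2
    then show ?thesis using scale[of "1 - t" x] assms by simp
  next
    case 3
    then show ?thesis
      using convex_onD[OF powr_convex[OF \<open>1 \<le> p\<close>], of t x y] assms by simp
  qed
qed

lemma powr_add_le_subadditive:
  fixes a b q :: real
  assumes "0 < q" "q \<le> 1" "0 \<le> a" "0 \<le> b"
  shows "(a + b) powr q \<le> a powr q + b powr q"
proof (cases "a + b = 0")
  case False
  then have pos: "0 < a + b" using assms by linarith
  have frac: "x \<le> x powr q" if "0 \<le> x" "x \<le> 1" for x :: real
    using that assms powr_mono'[of q 1 x] by (cases "x = 0") auto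
  have "1 = a / (a + b) + b / (a + b)" using pos by (simp add: add_divide_distrib[symmetric])
  also have "\<dots> \<le> (a / (a + b)) powr q + (b / (a + b)) powr q"
    using assms pos by (intro add_mono frac) auto
  also have "\<dots> = (a powr q + b powr q) / (a + b) powr q"
    by (simp add: powr_divide add_divide_distrib)
  finally show ?thesis using pos by (simp add: field_simps)
qed (use assms in simp)

lemma lp_moment_le_iff:
  assumes p: "0 < p" and a: "0 \<le> a"
  shows "lp_moment p M f \<le> ennreal a \<longleftrightarrow> (\<integral>\<^sup>+ z. ennreal (\<bar>f z\<bar> powr p) \<partial>M) \<le> ennreal (a powr p)"
proof (cases "(\<integral>\<^sup>+ z. ennreal (\<bar>f z\<bar> powr p) \<partial>M)")
  case (real x)
  have "x powr (1 / p) \<le> a \<longleftrightarrow> x \<le> a powr p"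
  proof
    assume "x powr (1 / p) \<le> a"
    then have "(x powr (1 / p)) powr p \<le> a powr p" using p by (intro powr_mono2) auto
    then show "x \<le> a powr p" using p real by (simp add: powr_powr)
  next
    assume "x \<le> a powr p"
    then have "x powr (1 / p) \<le> (a powr p) powr (1 / p)" using p real by (intro powr_mono2) auto
    then show "x powr (1 / p) \<le> a" using p a by (simp add: powr_powr)
  qed
  then show ?thesis using real a by (simp add: lp_moment_def Let_def ennreal_le_iff)
next
  case top
  then show ?thesis by (simp add: lp_moment_def Let_def top_unique)
qed

text \<open>
  Minkowski's inequality. For bounds \<open>a', b' > 0\<close>, the ratio \<open>\<bar>f + g\<bar> / (a' + b')\<close> is below a convex
  combination of \<open>\<bar>f\<bar> / a'\<close> and \<open>\<bar>g\<bar> / b'\<close>; raise it to the power \<open>p\<close> and integrate. Enlarging both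
  bounds by \<open>e / 2\<close> makes them positive.
\<close>

lemma lp_moment_add_le:
  assumes p: "1 \<le> p" and a: "0 \<le> a" "0 \<le> b"
    and fm: "f \<in> borel_measurable M" and gm: "g \<in> borel_measurable M"
    and f: "lp_moment p M f \<le> ennreal a" and g: "lp_moment p M g \<le> ennreal b"
  shows "lp_moment p M (\<lambda>z. f z + g z) \<le> ennreal (a + b)"
proof (rule ennreal_le_epsilon)
  fix e :: real assume e: "0 < e"
  define a' b' where "a' = a + e / 2" and "b' = b + e / 2"
  have pos: "a' > 0" "b' > 0" using a e by (auto simp: a'_def b'_def)
  have p0: "0 < p" using p by simp
  have fa: "(\<integral>\<^sup>+ z. ennreal (\<bar>f z\<bar> powr p) \<partial>M) \<le> ennreal (a' powr p)"
    using lp_moment_le_iff[OF p0, of a' M f] f pos e order.trans[OF f, of "ennreal a'"]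
    by (simp add: a'_def ennreal_leI)
  have gb: "(\<integral>\<^sup>+ z. ennreal (\<bar>g z\<bar> powr p) \<partial>M) \<le> ennreal (b' powr p)"
    using lp_moment_le_iff[OF p0, of b' M g] g pos e order.trans[OF g, of "ennreal b'"]
    by (simp add: b'_def ennreal_leI)
  define t where "t = b' / (a' + b')"
  have t: "0 \<le> t" "t \<le> 1" "1 - t = a' / (a' + b')" using pos by (auto simp: t_def field_simps)
  define A B where "A = (a' + b') powr p * (1 - t) / a' powr p" and "B = (a' + b') powr p * t / b' powr p"
  have AB: "0 \<le> A" "0 \<le> B" using t(1,2) by (auto simp: A_def B_def)
  have pt: "\<bar>f z + g z\<bar> powr p \<le> A * \<bar>f z\<bar> powr p + B * \<bar>g z\<bar> powr p" for z
  proof -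
    have "(1 - t) * (\<bar>f z\<bar> / a') + t * (\<bar>g z\<bar> / b') = (\<bar>f z\<bar> + \<bar>g z\<bar>) / (a' + b')"
    proof -
      have "(1 - t) * (\<bar>f z\<bar> / a') = \<bar>f z\<bar> / (a' + b')" unfolding t(3) using pos by simp
      moreover have "t * (\<bar>g z\<bar> / b') = \<bar>g z\<bar> / (a' + b')" unfolding t_def using pos by simp
      ultimately show ?thesis by (simp add: add_divide_distrib)
    qed
    then have "((\<bar>f z\<bar> + \<bar>g z\<bar>) / (a' + b')) powr p \<le> (1 - t) * (\<bar>f z\<bar> / a') powr p + t * (\<bar>g z\<bar> / b') powr p"
      using powr_convex_combination_le[OF p _ _ t(1,2), of "\<bar>f z\<bar> / a'" "\<bar>g z\<bar> / b'"] pos by simp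
    then have "(a' + b') powr p * ((\<bar>f z\<bar> + \<bar>g z\<bar>) / (a' + b')) powr p
        \<le> (a' + b') powr p * ((1 - t) * (\<bar>f z\<bar> / a') powr p + t * (\<bar>g z\<bar> / b') powr p)"
      by (intro mult_left_mono) auto
    moreover have "(a' + b') powr p * ((\<bar>f z\<bar> + \<bar>g z\<bar>) / (a' + b')) powr p = (\<bar>f z\<bar> + \<bar>g z\<bar>) powr p"
      using pos by (simp add: powr_mult[symmetric])
    moreover have "\<bar>f z + g z\<bar> powr p \<le> (\<bar>f z\<bar> + \<bar>g z\<bar>) powr p"
      using p by (intro powr_mono2) auto
    ultimately show ?thesis
      using pos by (simp add: A_def B_def powr_divide algebra_simps)
  qed
  have "(\<integral>\<^sup>+ z. ennreal (\<bar>f z + g z\<bar> powr p) \<partial>M)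
      \<le> (\<integral>\<^sup>+ z. ennreal A * ennreal (\<bar>f z\<bar> powr p) + ennreal B * ennreal (\<bar>g z\<bar> powr p) \<partial>M)"
    using pt AB by (intro nn_integral_mono) (simp add: ennreal_mult[symmetric] ennreal_plus[symmetric] ennreal_leI del: ennreal_plus)
  also have "\<dots> = ennreal A * (\<integral>\<^sup>+ z. ennreal (\<bar>f z\<bar> powr p) \<partial>M) + ennreal B * (\<integral>\<^sup>+ z. ennreal (\<bar>g z\<bar> powr p) \<partial>M)"
    using fm gm by (simp add: nn_integral_add nn_integral_cmult)
  also have "\<dots> \<le> ennreal A * ennreal (a' powr p) + ennreal B * ennreal (b' powr p)"
    by (intro add_mono mult_left_mono fa gb) auto
  also have "\<dots> = ennreal (A * a' powr p + B * b' powr p)"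
    using AB by (simp add: ennreal_mult[symmetric] ennreal_plus[symmetric] del: ennreal_plus)
  also have "A * a' powr p + B * b' powr p = (a' + b') powr p"
  proof -
    have "A * a' powr p = (a' + b') powr p * (1 - t)" "B * b' powr p = (a' + b') powr p * t"
      using pos by (simp_all add: A_def B_def)
    then show ?thesis by (simp add: algebra_simps)
  qed
  finally have "lp_moment p M (\<lambda>z. f z + g z) \<le> ennreal (a' + b')"
    using lp_moment_le_iff[OF p0, of "a' + b'" M "\<lambda>z. f z + g z"] pos by simp
  also have "a' + b' = (a + b) + e" by (simp add: a'_def b'_def)
  also have "ennreal ((a + b) + e) = ennreal (a + b) + ennreal e"
    using a e by (intro ennreal_plus) auto
  finally show "lp_moment p M (\<lambda>z. f z + g z) \<le> ennreal (a + b) + ennreal e" .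
qed

lemma lp_moment_distr:
  assumes "T \<in> measurable M N" "f \<in> borel_measurable N"
  shows "lp_moment p (distr M N T) f = lp_moment p M (\<lambda>z. f (T z))"
proof -
  have "(\<lambda>z. ennreal (\<bar>f z\<bar> powr p)) \<in> borel_measurable N" using assms(2) by measurable
  then show ?thesis unfolding lp_moment_def using assms by (simp add: nn_integral_distr)
qed

lemma lp_moment_eq_integral:
  assumes "integrable M (\<lambda>z. \<bar>f z\<bar> powr p)"
  shows "lp_moment p M f = ennreal ((\<integral>z. \<bar>f z\<bar> powr p \<partial>M) powr (1 / p))"
proof -
  have "(\<integral>\<^sup>+ z. ennreal (\<bar>f z\<bar> powr p) \<partial>M) = ennreal (\<integral>z. \<bar>f z\<bar> powr p \<partial>M)"
    using assms by (intro nn_integral_eq_integral) auto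
  then show ?thesis by (simp add: lp_moment_def Let_def)
qed

lemma integrable_if_lp_moment_finite:
  assumes "lp_moment p M f < \<infinity>" "f \<in> borel_measurable M"
  shows "integrable M (\<lambda>z. \<bar>f z\<bar> powr p)"
proof (rule integrableI_nonneg)
  show "(\<lambda>z. \<bar>f z\<bar> powr p) \<in> borel_measurable M" using assms(2) by measurable
  show "(\<integral>\<^sup>+ z. ennreal (\<bar>f z\<bar> powr p) \<partial>M) < \<infinity>"
    using assms(1) by (auto simp: lp_moment_def Let_def less_top split: if_splits)
qed simp

text \<open>
  Pointwise, \<open>((a + b) / 2)\<^sup>2\<^sup>r \<le> 1 + ((a + b) / 2)\<^sup>s\<close>, and the last power is at most the mean of \<open>a\<^sup>s\<close> and
  \<open>b\<^sup>s\<close> by convexity.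
\<close>

lemma envelope_second_moment:
  fixes a b :: "'b \<Rightarrow> real" and r s :: real
  assumes P: "prob_space P" and r: "1 \<le> r" and s: "2 * r < s"
    and m: "a \<in> borel_measurable P" "b \<in> borel_measurable P"
    and nn: "\<And>z. 0 \<le> a z" "\<And>z. 0 \<le> b z"
    and a: "(\<integral>\<^sup>+ z. ennreal (a z powr s) \<partial>P) \<le> 1" and b: "(\<integral>\<^sup>+ z. ennreal (b z powr s) \<partial>P) \<le> 1"
  shows "(\<integral>\<^sup>+ z. ennreal ((a z + b z) powr (2 * r)) \<partial>P) \<le> ennreal (2 * 4 powr r)"
proof -
  interpret prob_space P by fact
  define A B :: real where "A = 4 powr r" and "B = 4 powr r / 2"
  have AB: "0 \<le> A" "0 \<le> B" by (auto simp: A_def B_def)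
  have pt: "(a z + b z) powr (2 * r) \<le> A + (B * a z powr s + B * b z powr s)" for z
  proof -
    define x where "x = (1 - 1/2) * a z + (1/2) * b z"
    have x0: "0 \<le> x" using nn[of z] by (simp add: x_def)
    have "(a z + b z) powr (2 * r) = (2 * x) powr (2 * r)" by (simp add: x_def algebra_simps)
    also have "\<dots> = 2 powr (2 * r) * x powr (2 * r)" using x0 by (simp add: powr_mult)
    also have "(2 :: real) powr (2 * r) = 4 powr r" by (simp add: powr_powr[symmetric])
    also have "x powr (2 * r) \<le> 1 + x powr s"
    proof (cases "x \<le> 1")
      case True
      then have "x powr (2 * r) \<le> 1" using x0 r by (intro powr_le1) auto
      moreover have "0 \<le> x powr s" by simp
      ultimately show ?thesis by linarith
    next
      case False
      then have "x powr (2 * r) \<le> x powr s" using s by (intro powr_mono) auto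
      then show ?thesis by simp
    qed
    also have "x powr s \<le> (1 - 1/2) * a z powr s + (1/2) * b z powr s"
      unfolding x_def using nn[of z] r s by (intro powr_convex_combination_le) auto
    finally show ?thesis by (simp add: A_def B_def algebra_simps)
  qed
  have "(\<integral>\<^sup>+ z. ennreal ((a z + b z) powr (2 * r)) \<partial>P)
     \<le> (\<integral>\<^sup>+ z. ennreal A + (ennreal B * ennreal (a z powr s) + ennreal B * ennreal (b z powr s)) \<partial>P)"
    using pt AB by (intro nn_integral_mono)
      (simp add: ennreal_mult[symmetric] ennreal_plus[symmetric] ennreal_leI del: ennreal_plus)
  also have "\<dots> = ennreal A + (ennreal B * (\<integral>\<^sup>+ z. ennreal (a z powr s) \<partial>P)
      + ennreal B * (\<integral>\<^sup>+ z. ennreal (b z powr s) \<partial>P))"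
    using m by (simp add: nn_integral_cmult nn_integral_add emeasure_space_1)
  also have "\<dots> \<le> ennreal A + (ennreal B * 1 + ennreal B * 1)"
    by (intro mult_left_mono add_mono a b order.refl) auto
  also have "\<dots> = ennreal (2 * 4 powr r)"
    using AB by (simp add: ennreal_plus[symmetric] A_def B_def del: ennreal_plus)
  finally show ?thesis .
qed

section \<open>Residuals\<close>

lemma resid_measurable [measurable]: "resid \<beta> \<in> borel_measurable borel"
  unfolding resid_def by (intro borel_measurable_continuous_onI continuous_intros)

text \<open>
  The infimum over couplings may fail to be attained, whence the slack \<open>\<eta>\<close>. It is chosen so that the
  factor \<open>\<sigma> + \<rho> \<beta>\<close> turns it into \<open>e\<close>.
\<close>

lemma lp_moment_resid_wasserstein:
  assumes p: "1 \<le> p" and pos: "0 < \<sigma> + \<rho> \<beta>" and "0 \<le> \<epsilon>" "0 \<le> a"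
    and W: "max_sliced_wasserstein p \<rho> \<sigma> P Q \<le> ennreal \<epsilon>"
    and a: "lp_moment p P (resid \<beta>) \<le> ennreal a"
  shows "lp_moment p Q (resid \<beta>) \<le> ennreal (a + \<epsilon> * (\<sigma> + \<rho> \<beta>))"
proof (rule ennreal_le_epsilon)
  fix e :: real assume e: "0 < e"
  define \<eta> where "\<eta> = e / (\<sigma> + \<rho> \<beta>)"
  have \<eta>: "0 < \<eta>" "\<eta> * (\<sigma> + \<rho> \<beta>) = e" using e pos by (auto simp: \<eta>_def)
  let ?d = "\<lambda>(z, z'). resid \<beta> z - resid \<beta> z'"
  have "(INF \<pi>\<in>couplings P Q. ennreal (1 / (\<sigma> + \<rho> \<beta>)) * lp_moment p \<pi> ?d) \<le> ennreal \<epsilon>"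
    by (rule order.trans[OF _ W]) (unfold max_sliced_wasserstein_def, rule SUP_upper, simp)
  also have "ennreal \<epsilon> < ennreal (\<epsilon> + \<eta>)" using \<open>0 \<le> \<epsilon>\<close> \<eta> by (simp add: ennreal_less_iff)
  finally obtain \<pi> where \<pi>: "\<pi> \<in> couplings P Q"
    and lt: "ennreal (1 / (\<sigma> + \<rho> \<beta>)) * lp_moment p \<pi> ?d < ennreal (\<epsilon> + \<eta>)"
    unfolding INF_less_iff by blast
  have s: "sets \<pi> = sets (borel \<Otimes>\<^sub>M borel)" and P: "distr \<pi> borel fst = P" and Q: "distr \<pi> borel snd = Q"
    using \<pi> by (auto simp: couplings_def)
  have fst: "fst \<in> measurable \<pi> borel" and snd: "snd \<in> measurable \<pi> borel"
    unfolding measurable_cong_sets[OF s refl] by measurable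
  have d: "lp_moment p \<pi> ?d \<le> ennreal ((\<epsilon> + \<eta>) * (\<sigma> + \<rho> \<beta>))"
  proof -
    have "lp_moment p \<pi> ?d = ennreal (\<sigma> + \<rho> \<beta>) * (ennreal (1 / (\<sigma> + \<rho> \<beta>)) * lp_moment p \<pi> ?d)"
      using pos by (simp add: mult.assoc[symmetric] ennreal_mult[symmetric])
    also have "\<dots> \<le> ennreal (\<sigma> + \<rho> \<beta>) * ennreal (\<epsilon> + \<eta>)"
      using lt by (intro mult_left_mono) auto
    also have "\<dots> = ennreal ((\<epsilon> + \<eta>) * (\<sigma> + \<rho> \<beta>))"
      using pos \<eta> \<open>0 \<le> \<epsilon>\<close> by (subst ennreal_mult[symmetric]) (auto simp: mult.commute)
    finally show ?thesis .
  qed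
  have dm: "lp_moment p \<pi> (\<lambda>z. - ?d z) \<le> ennreal ((\<epsilon> + \<eta>) * (\<sigma> + \<rho> \<beta>))"
    using d by (simp add: lp_moment_def)
  have m: "(\<lambda>z. resid \<beta> (fst z)) \<in> borel_measurable \<pi>" "(\<lambda>z. resid \<beta> (snd z)) \<in> borel_measurable \<pi>"
    using measurable_compose[OF fst resid_measurable] measurable_compose[OF snd resid_measurable] by auto
  have "(\<lambda>z. - ?d z) = (\<lambda>z. resid \<beta> (snd z) - resid \<beta> (fst z))" by (auto simp: fun_eq_iff)
  then have m': "(\<lambda>z. - ?d z) \<in> borel_measurable \<pi>" using m by simp
  have Pf: "lp_moment p \<pi> (\<lambda>z. resid \<beta> (fst z)) \<le> ennreal a"
    using a unfolding P[symmetric] lp_moment_distr[OF fst resid_measurable] .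
  have "lp_moment p Q (resid \<beta>) = lp_moment p \<pi> (\<lambda>z. resid \<beta> (snd z))"
    unfolding Q[symmetric] by (rule lp_moment_distr[OF snd resid_measurable])
  also have "(\<lambda>z. resid \<beta> (snd z)) = (\<lambda>z. resid \<beta> (fst z) + - ?d z)" by (auto simp: fun_eq_iff)
  also have "lp_moment p \<pi> (\<lambda>z. resid \<beta> (fst z) + - ?d z) \<le> ennreal (a + (\<epsilon> + \<eta>) * (\<sigma> + \<rho> \<beta>))"
    using pos \<eta> \<open>0 \<le> \<epsilon>\<close> \<open>0 \<le> a\<close> by (intro lp_moment_add_le[OF p _ _ m(1) m' Pf dm]) auto
  also have "a + (\<epsilon> + \<eta>) * (\<sigma> + \<rho> \<beta>) = (a + \<epsilon> * (\<sigma> + \<rho> \<beta>)) + e"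
    using \<eta>(2) by (simp add: algebra_simps)
  also have "ennreal \<dots> = ennreal (a + \<epsilon> * (\<sigma> + \<rho> \<beta>)) + ennreal e"
    using e pos \<open>0 \<le> \<epsilon>\<close> \<open>0 \<le> a\<close> by (intro ennreal_plus) auto
  finally show "lp_moment p Q (resid \<beta>) \<le> ennreal (a + \<epsilon> * (\<sigma> + \<rho> \<beta>)) + ennreal e" .
qed

lemma lp_moment_empirical:
  assumes n: "1 \<le> n" and f: "f \<in> borel_measurable borel"
  shows "lp_moment p (empirical_measure n z) f = ennreal (((\<Sum>i<n. \<bar>f (z i)\<bar> powr p) / n) powr (1 / p))"
proof -
  have "(\<integral>\<^sup>+ x. ennreal (\<bar>f x\<bar> powr p) \<partial>empirical_measure n z)
     = (\<integral>\<^sup>+ i. ennreal (\<bar>f (z i)\<bar> powr p) \<partial>uniform_count_measure {..<n})"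
    unfolding empirical_measure_def
  proof (rule nn_integral_distr)
    show "z \<in> measurable (uniform_count_measure {..<n}) borel"
      by (auto simp: measurable_def sets_uniform_count_measure space_uniform_count_measure)
    show "(\<lambda>x. ennreal (\<bar>f x\<bar> powr p)) \<in> borel_measurable (distr (uniform_count_measure {..<n}) borel z)"
      using f by measurable
  qed
  also have "\<dots> = (\<Sum>i<n. ennreal (1 / n) * ennreal (\<bar>f (z i)\<bar> powr p))"
    unfolding uniform_count_measure_def by (subst nn_integral_point_measure_finite) auto
  also have "\<dots> = ennreal ((\<Sum>i<n. \<bar>f (z i)\<bar> powr p) / n)"
    by (simp add: ennreal_mult[symmetric] sum_divide_distrib)
  finally show ?thesis by (simp add: lp_moment_def Let_def sum_nonneg)
qed

text \<open>
  The integral is a finite convex function of \<open>\<beta>\<close>, hence continuous.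
\<close>

lemma continuous_integral_resid_powr:
  fixes Q :: "((real^'d) \<times> real) measure"
  assumes "1 \<le> p" and int: "\<And>\<beta>. integrable Q (\<lambda>z. \<bar>resid \<beta> z\<bar> powr p)"
  shows "continuous_on UNIV (\<lambda>\<beta>. \<integral>z. \<bar>resid \<beta> z\<bar> powr p \<partial>Q)"
proof (rule convex_on_continuous)
  show "convex_on UNIV (\<lambda>\<beta>. \<integral>z. \<bar>resid \<beta> z\<bar> powr p \<partial>Q)"
  proof (rule convex_onI)
    fix t :: real and x y :: "real^'d" assume t: "0 < t" "t < 1"
    have pt: "\<bar>resid ((1 - t) *\<^sub>R x + t *\<^sub>R y) z\<bar> powr p
        \<le> (1 - t) * \<bar>resid x z\<bar> powr p + t * \<bar>resid y z\<bar> powr p" for z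
    proof -
      have "resid ((1 - t) *\<^sub>R x + t *\<^sub>R y) z = (1 - t) * resid x z + t * resid y z"
        by (simp add: resid_def inner_add_right algebra_simps)
      then have "\<bar>resid ((1 - t) *\<^sub>R x + t *\<^sub>R y) z\<bar> \<le> (1 - t) * \<bar>resid x z\<bar> + t * \<bar>resid y z\<bar>"
        using t abs_triangle_ineq[of "(1 - t) * resid x z" "t * resid y z"] by (simp add: abs_mult)
      then have "\<bar>resid ((1 - t) *\<^sub>R x + t *\<^sub>R y) z\<bar> powr p \<le> ((1 - t) * \<bar>resid x z\<bar> + t * \<bar>resid y z\<bar>) powr p"
        using \<open>1 \<le> p\<close> by (intro powr_mono2) auto
      also have "\<dots> \<le> (1 - t) * \<bar>resid x z\<bar> powr p + t * \<bar>resid y z\<bar> powr p"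
        using t by (intro powr_convex_combination_le \<open>1 \<le> p\<close>) auto
      finally show ?thesis .
    qed
    have "(\<integral>z. \<bar>resid ((1 - t) *\<^sub>R x + t *\<^sub>R y) z\<bar> powr p \<partial>Q)
        \<le> (\<integral>z. (1 - t) * \<bar>resid x z\<bar> powr p + t * \<bar>resid y z\<bar> powr p \<partial>Q)"
      using int pt by (intro integral_mono) auto
    also have "\<dots> = (1 - t) * (\<integral>z. \<bar>resid x z\<bar> powr p \<partial>Q) + t * (\<integral>z. \<bar>resid y z\<bar> powr p \<partial>Q)"
      using int by simp
    finally show "(\<integral>z. \<bar>resid ((1 - t) *\<^sub>R x + t *\<^sub>R y) z\<bar> powr p \<partial>Q)
        \<le> (1 - t) * (\<integral>z. \<bar>resid x z\<bar> powr p \<partial>Q) + t * (\<integral>z. \<bar>resid y z\<bar> powr p \<partial>Q)" .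
  qed simp
qed simp

lemma le_everywhere_if_le_on_dense:
  fixes f g :: "'a::topological_space \<Rightarrow> real"
  assumes f: "continuous_on UNIV f" and g: "continuous_on UNIV g"
    and dense: "\<And>X. open X \<Longrightarrow> X \<noteq> {} \<Longrightarrow> \<exists>d\<in>B. d \<in> X"
    and le: "\<And>x. x \<in> B \<Longrightarrow> f x \<le> g x"
  shows "f x \<le> g x"
proof (rule ccontr)
  assume "\<not> f x \<le> g x"
  then have "{x. g x < f x} \<noteq> {}" by (auto simp: not_le)
  moreover have "open {x. g x < f x}" using f g by (intro open_Collect_less)
  ultimately have "\<exists>d\<in>B. d \<in> {x. g x < f x}" by (intro dense) auto
  then obtain d where "d \<in> B" "g d < f d" by auto
  then show False using le[of d] by linarith
qed

section \<open>The deviation bound for residuals\<close>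

text \<open>
  The law of an i.i.d. sample is a product measure; here for events \<open>Q\<close> that depend on the first \<open>n\<close>
  observations only.
\<close>

lemma indep_sample_emeasure:
  fixes Z :: "nat \<Rightarrow> 'w \<Rightarrow> 'a::topological_space"
  assumes M: "prob_space M" and P: "sets P = sets borel" and n: "1 \<le> n"
    and ind: "prob_space.indep_vars M (\<lambda>_. borel) Z {..<n}"
    and law: "\<And>i. i < n \<Longrightarrow> distr M borel (Z i) = P"
    and E: "{z \<in> space (PiM {..<n} (\<lambda>_. P)). Q z} \<in> sets (PiM {..<n} (\<lambda>_. P))"
    and local: "\<And>z. Q (\<lambda>i\<in>{..<n}. z i) \<longleftrightarrow> Q z"
  shows "{\<omega> \<in> space M. Q (\<lambda>i. Z i \<omega>)} \<in> sets M"
    and "emeasure M {\<omega> \<in> space M. Q (\<lambda>i. Z i \<omega>)} = emeasure (PiM {..<n} (\<lambda>_. P)) {z \<in> space (PiM {..<n} (\<lambda>_. P)). Q z}"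
proof -
  interpret prob_space M by fact
  have rv: "Z i \<in> measurable M borel" if "i \<in> {..<n}" for i
    using ind that unfolding indep_vars_def by blast
  let ?X = "\<lambda>\<omega>. \<lambda>i\<in>{..<n}. Z i \<omega>"
  have "distr M (PiM {..<n} (\<lambda>_. borel)) ?X = PiM {..<n} (\<lambda>i. distr M borel (Z i))"
    using indep_vars_iff_distr_eq_PiM'[of "{..<n}" Z "\<lambda>_. borel"] ind rv n by (auto simp: lessThan_empty_iff)
  also have "\<dots> = PiM {..<n} (\<lambda>_. P)" using law by (intro PiM_cong) auto
  finally have d: "distr M (PiM {..<n} (\<lambda>_. borel)) ?X = PiM {..<n} (\<lambda>_. P)" .
  have s: "sets (PiM {..<n} (\<lambda>_. P)) = sets (PiM {..<n} (\<lambda>_. borel))"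
    using P by (intro sets_PiM_cong) auto
  have X: "?X \<in> measurable M (PiM {..<n} (\<lambda>_. borel))" using rv by (intro measurable_restrict) auto
  let ?E = "{z \<in> space (PiM {..<n} (\<lambda>_. P)). Q z}"
  have pre: "?X -` ?E \<inter> space M = {\<omega> \<in> space M. Q (\<lambda>i. Z i \<omega>)}"
    using measurable_space[OF X] local[of "\<lambda>i. Z i _"] sets_eq_imp_space_eq[OF s] by auto
  show "{\<omega> \<in> space M. Q (\<lambda>i. Z i \<omega>)} \<in> sets M"
    using measurable_sets[OF X, of ?E] E s pre by simp
  show "emeasure M {\<omega> \<in> space M. Q (\<lambda>i. Z i \<omega>)} = emeasure (PiM {..<n} (\<lambda>_. P)) ?E"
    using emeasure_distr[OF X, of ?E] E s pre unfolding d by simp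
qed

text \<open>
  The lower bound comes from the last summand of \<open>C\<close>. With \<open>x = s / 2 - r\<close> the factor \<open>2\<^sup>s / x\<^sup>2\<close> is bounded below because
  \<open>x \<le> s / 2 \<le> s * ln 2\<close> and \<open>t\<^sup>2 / 2 \<le> exp t\<close>.
\<close>

lemma sample_constant_bound:
  fixes r s \<alpha> m C :: real
  assumes "1 \<le> r" "0 < \<alpha>" "\<alpha> < 1" "2 * r < s" "0 \<le> m"
    and C: "C = 2 powr r * r *
           (180 * sqrt m + sqrt (2 * ln (1 / \<alpha>))
            + sqrt (2 powr s / \<alpha>) * (8 / (s / 2 - r)) * sqrt (ln (8 / \<alpha>) + m))"
  shows "0 \<le> C" and "16 * 4 powr r * r\<^sup>2 * m \<le> \<alpha> * C\<^sup>2"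
proof -
  define x where "x = s / 2 - r"
  have x: "0 < x" "x \<le> s / 2" using assms by (auto simp: x_def)
  have ln0: "0 \<le> ln (1 / \<alpha>)" "0 \<le> ln (8 / \<alpha>)" using assms by (auto intro!: ln_ge_zero)
  define R where "R = sqrt (2 powr s / \<alpha>) * (8 / x) * sqrt (ln (8 / \<alpha>) + m)"
  have R0: "0 \<le> R" using x ln0 assms by (simp add: R_def)
  have CR: "2 powr r * r * R \<le> C"
    unfolding C R_def x_def using ln0 assms by (intro mult_left_mono) auto
  moreover have base: "0 \<le> 2 powr r * r * R" using R0 assms by simp
  ultimately show "0 \<le> C" by linarith
  have two: "x\<^sup>2 / 2 \<le> 2 powr s"
  proof -
    have "s * (2 / 3) \<le> s * ln 2"
      using assms ln2_ge_two_thirds by (intro mult_left_mono) auto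
    then have "x \<le> s * ln 2" using x by linarith
    then have "x\<^sup>2 \<le> (s * ln 2)\<^sup>2" using x by (intro power_mono) auto
    moreover have "0 \<le> s * ln 2" using assms by simp
    ultimately have "x\<^sup>2 / 2 \<le> 1 + s * ln 2 + (s * ln 2)\<^sup>2 / 2" by linarith
    also have "\<dots> \<le> exp (s * ln 2)" using assms by (intro exp_lower_Taylor_quadratic) auto
    finally show ?thesis by (simp add: powr_def)
  qed
  have "\<alpha> * R\<^sup>2 = 64 * (2 powr s / x\<^sup>2) * (ln (8 / \<alpha>) + m)"
    using assms ln0 x by (simp add: R_def power_mult_distrib power_divide)
  moreover have "32 * m \<le> 64 * (2 powr s / x\<^sup>2) * (ln (8 / \<alpha>) + m)"
  proof -
    have "1 / 2 \<le> 2 powr s / x\<^sup>2" using two x by (simp add: field_simps)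
    then have "64 * (1 / 2) * m \<le> 64 * (2 powr s / x\<^sup>2) * (ln (8 / \<alpha>) + m)"
      using ln0 assms by (intro mult_mono) auto
    then show ?thesis by simp
  qed
  ultimately have "16 * m \<le> \<alpha> * R\<^sup>2" using assms by linarith
  then have "(4 powr r * r\<^sup>2) * (16 * m) \<le> (4 powr r * r\<^sup>2) * (\<alpha> * R\<^sup>2)"
    using assms by (intro mult_left_mono) auto
  also have "\<dots> = \<alpha> * (2 powr r * r * R)\<^sup>2"
  proof -
    have "(4::real) powr r = 2 powr r * 2 powr r" by (simp add: powr_mult[symmetric])
    then show ?thesis by (simp add: power2_eq_square)
  qed
  also have "\<dots> \<le> \<alpha> * C\<^sup>2" using CR base assms by (intro mult_left_mono power_mono) auto
  finally show "16 * 4 powr r * r\<^sup>2 * m \<le> \<alpha> * C\<^sup>2" by (simp add: algebra_simps)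
qed

theorem theorem7:
  fixes r \<alpha> s c\<^sub>d \<sigma> C \<delta> \<epsilon> :: real
    and n :: nat
    and \<rho> :: "real^'d \<Rightarrow> real"
    and N :: "(real^'d) \<times> real \<Rightarrow> real"
    and P Q :: "((real^'d) \<times> real) measure"
    and M :: "'w measure"
    and Z :: "nat \<Rightarrow> 'w \<Rightarrow> (real^'d) \<times> real"
  assumes "r \<ge> 1" and "0 < \<alpha>" and "\<alpha> < 1"
    and "convex_penalty \<rho>"
    and "is_norm N"
    and "c\<^sub>d > 0" and "\<And>\<gamma>. c\<^sub>d * N (\<gamma>, -1) \<le> \<rho> \<gamma> + 1"
    and "prob_space P" and "sets P = sets borel"
    and "prob_space M" and "n \<ge> 1"
    and "prob_space.indep_vars M (\<lambda>_. borel) Z {..<n}"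
    and "\<And>i. i < n \<Longrightarrow> distr M borel (Z i) = P"
    and "s > 2 * r"
    and "(\<integral>\<^sup>+ (x, y). ennreal (dual_norm N (x, 0) powr s) \<partial>P) = 1"
    and "lp_moment s P (\<lambda>(x, y). dual_norm N (0, y)) < \<infinity>"
    and "\<sigma> = max (enn2real (lp_moment s P (\<lambda>(x, y). dual_norm N (0, y)))) 1"
    and "C = 2 powr r * r *
           (180 * sqrt (real CARD('d) + 2) + sqrt (2 * ln (1 / \<alpha>))
            + sqrt (2 powr s / \<alpha>) * (8 / (s / 2 - r))
              * sqrt (ln (8 / \<alpha>) + (real CARD('d) + 2)))"
    and "\<delta> = max (1 / c\<^sub>d) 1 *
           (C * ln (2 * real n + 1) powr (r / s) / sqrt (real n)) powr (1 / r)"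
    and "\<epsilon> \<ge> 0"
    and "prob_space Q" and "sets Q = sets borel"
    and "max_sliced_wasserstein r \<rho> \<sigma> P Q \<le> ennreal \<epsilon>"
  shows "measure M {\<omega> \<in> space M. \<forall>\<beta>.
           lp_moment r Q (resid \<beta>)
             \<le> lp_moment r (empirical_measure n (\<lambda>i. Z i \<omega>)) (resid \<beta>)
                + ennreal ((\<delta> + \<epsilon>) * (\<sigma> + \<rho> \<beta>))} > 1 - 3 * \<alpha>"
proof -
  interpret M: prob_space M by fact
  note r1 = \<open>r \<ge> 1\<close> and \<alpha>0 = \<open>0 < \<alpha>\<close> and \<alpha>1 = \<open>\<alpha> < 1\<close> and \<rho>pen = \<open>convex_penalty \<rho>\<close>
    and norm = \<open>is_norm N\<close> and c0 = \<open>c\<^sub>d > 0\<close> and n1 = \<open>n \<ge> 1\<close> and sr = \<open>s > 2 * r\<close>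
    and setsP = \<open>sets P = sets borel\<close> and setsQ = \<open>sets Q = sets borel\<close> and \<epsilon>0 = \<open>\<epsilon> \<ge> 0\<close>
  have \<sigma>1: "1 \<le> \<sigma>" unfolding \<open>\<sigma> = _\<close> by simp
  have \<rho>0: "0 \<le> \<rho> \<beta>" for \<beta> using \<rho>pen by (simp add: convex_penalty_def)
  have pos: "0 < \<sigma> + \<rho> \<beta>" for \<beta> using \<sigma>1 \<rho>0[of \<beta>] by linarith
  define w where "w = (\<lambda>z :: (real^'d) \<times> real. (fst z, snd z / \<sigma>))"
  define a b where "a = (\<lambda>z :: (real^'d) \<times> real. dual_norm N (fst z, 0))"
    and "b = (\<lambda>z :: (real^'d) \<times> real. dual_norm N (0, snd z) / \<sigma>)"
  define k where "k = (\<lambda>\<beta>. c\<^sub>d / (\<sigma> + \<rho> \<beta>))"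
  define u where "u = (\<lambda>\<beta>. k \<beta> *\<^sub>R (\<beta>, - \<sigma>))"
  have kpos: "0 < k \<beta>" for \<beta> using pos[of \<beta>] c0 by (simp add: k_def)
  have wu: "w z \<bullet> u \<beta> = - k \<beta> * resid \<beta> z" for z \<beta>
    using \<sigma>1 by (simp add: w_def u_def resid_def inner_Pair right_diff_distrib)
  have Nu: "N (u \<beta>) \<le> 1" for \<beta>
  proof -
    have "N (u \<beta>) = k \<beta> * N (\<beta>, - \<sigma>)" unfolding u_def is_normD(2)[OF norm] using kpos[of \<beta>] by simp
    also have "\<dots> = (c\<^sub>d * N (\<beta>, - \<sigma>)) / (\<sigma> + \<rho> \<beta>)" by (simp add: k_def)
    also have "\<dots> \<le> 1"
      using penalty_dominates_scaled_norm[OF \<rho>pen norm assms(7) \<sigma>1, of \<beta>] pos[of \<beta>] by simp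
    finally show ?thesis .
  qed
  have wD: "\<bar>w z \<bullet> u \<beta>\<bar> \<le> a z + b z" for z \<beta>
  proof -
    have unit: "d * N (u \<beta>) \<le> d" if "0 \<le> d" for d
      using mult_left_mono[OF Nu that] by simp
    have "w z = (fst z, 0) + (1 / \<sigma>) *\<^sub>R (0, snd z)" by (simp add: w_def)
    then have "w z \<bullet> u \<beta> = (fst z, 0) \<bullet> u \<beta> + (1 / \<sigma>) * ((0, snd z) \<bullet> u \<beta>)"
      by (simp only: inner_add_left inner_scaleR_left)
    then have "\<bar>w z \<bullet> u \<beta>\<bar> \<le> \<bar>(fst z, 0) \<bullet> u \<beta>\<bar> + (1 / \<sigma>) * \<bar>(0, snd z) \<bullet> u \<beta>\<bar>"
      using \<sigma>1 abs_triangle_ineq[of "(fst z, 0) \<bullet> u \<beta>" "(1 / \<sigma>) * ((0, snd z) \<bullet> u \<beta>)"]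
      by (simp only: abs_mult) simp
    also have "\<dots> \<le> dual_norm N (fst z, 0) + (1 / \<sigma>) * dual_norm N (0, snd z)"
      using \<sigma>1 by (intro add_mono mult_left_mono order.trans[OF inner_le_dual_norm[OF norm] unit] dual_norm_nonneg norm) auto
    finally show ?thesis by (simp add: a_def b_def)
  qed
  have a0: "0 \<le> a z" and b0: "0 \<le> b z" for z
    using dual_norm_nonneg[OF norm] \<sigma>1 by (auto simp: a_def b_def)
  have dm: "dual_norm N \<in> borel_measurable borel" by (rule dual_norm_measurable[OF norm])
  have cm: "f \<in> measurable P borel" if "continuous_on UNIV f" for f :: "_ \<Rightarrow> (real^'d) \<times> real"
    unfolding measurable_cong_sets[OF setsP refl] using that by (rule borel_measurable_continuous_onI)
  have am: "a \<in> borel_measurable P"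
    unfolding a_def by (intro measurable_compose[OF cm dm] continuous_intros)
  have dm2: "(\<lambda>z. dual_norm N (0, snd z)) \<in> borel_measurable P"
    by (intro measurable_compose[OF cm dm] continuous_intros)
  then have bm: "b \<in> borel_measurable P" unfolding b_def by measurable
  have wm: "w \<in> borel_measurable P" unfolding w_def using \<sigma>1 by (intro cm continuous_intros) auto
  have aint: "(\<integral>\<^sup>+ z. ennreal (a z powr s) \<partial>P) \<le> 1"
    using assms(15) by (simp add: a_def case_prod_beta')
  have bint: "(\<integral>\<^sup>+ z. ennreal (b z powr s) \<partial>P) \<le> 1"
  proof -
    let ?g = "\<lambda>(x, y). dual_norm N (0, y)"
    have "lp_moment s P ?g = ennreal (enn2real (lp_moment s P ?g))"
      using assms(16) by (simp add: less_top)
    also have "\<dots> \<le> ennreal \<sigma>" unfolding \<open>\<sigma> = _\<close> by (intro ennreal_leI) simp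
    finally have le: "(\<integral>\<^sup>+ z. ennreal (\<bar>?g z\<bar> powr s) \<partial>P) \<le> ennreal (\<sigma> powr s)"
      using lp_moment_le_iff[of s \<sigma> P ?g] sr r1 \<sigma>1 by simp
    have "(\<integral>\<^sup>+ z. ennreal (b z powr s) \<partial>P) = (\<integral>\<^sup>+ z. ennreal (1 / \<sigma> powr s) * ennreal (\<bar>?g z\<bar> powr s) \<partial>P)"
      using dual_norm_nonneg[OF norm] \<sigma>1
      by (intro nn_integral_cong) (simp add: b_def powr_divide ennreal_mult[symmetric] case_prod_beta')
    also have "\<dots> = ennreal (1 / \<sigma> powr s) * (\<integral>\<^sup>+ z. ennreal (\<bar>?g z\<bar> powr s) \<partial>P)"
      using dm2 by (intro nn_integral_cmult) (simp add: case_prod_beta')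
    also have "\<dots> \<le> ennreal (1 / \<sigma> powr s) * ennreal (\<sigma> powr s)" by (intro mult_left_mono le) simp
    also have "\<dots> = 1" using \<sigma>1 by (simp add: ennreal_mult[symmetric])
    finally show ?thesis .
  qed
  define \<kappa> where "\<kappa> = 2 * 4 powr r"
  have \<kappa>0: "0 \<le> \<kappa>" by (simp add: \<kappa>_def)
  have env: "(\<integral>\<^sup>+ z. ennreal ((a z + b z) powr (2 * r)) \<partial>P) \<le> ennreal \<kappa>"
    unfolding \<kappa>_def by (rule envelope_second_moment[OF \<open>prob_space P\<close> r1 sr am bm a0 b0 aint bint])
  have Dm: "(\<lambda>z. a z + b z) \<in> borel_measurable P" using am bm by measurable
  \<comment> \<open>The logarithm is at least \<open>ln 3 \<ge> 1\<close>, so the factor \<open>L\<close> can only enlarge the threshold.\<close>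
  define L where "L = ln (2 * real n + 1) powr (r / s)"
  have L1: "1 \<le> L"
  proof -
    have "exp 1 \<le> 2 * real n + 1" using exp_le n1 by linarith
    then have "1 \<le> ln (2 * real n + 1)" using ln_ge_iff[of "2 * real n + 1" 1] by simp
    then show ?thesis unfolding L_def using r1 sr by (intro ge_one_powr_ge_zero) auto
  qed
  have C0: "0 \<le> C" and Cb: "16 * 4 powr r * r\<^sup>2 * (real CARD('d) + 2) \<le> \<alpha> * C\<^sup>2"
    using sample_constant_bound[OF r1 \<alpha>0 \<alpha>1 sr _ assms(18)] by auto
  have Cpos: "0 < C"
  proof -
    have "0 < 16 * 4 powr r * r\<^sup>2 * (real CARD('d) + 2)" using r1 by simp
    then have "C \<noteq> 0" using Cb by auto
    then show ?thesis using C0 by simp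
  qed
  \<comment> \<open>The threshold for sums over the sample: \<open>T / n\<close> is the number under the \<open>r\<close>-th root in \<open>\<delta>\<close>.\<close>
  define T where "T = sqrt (real n) * C * L"
  have T0: "0 < T" using n1 Cpos L1 by (simp add: T_def)
  obtain B :: "(real^'d) set" where B: "countable B" "\<And>X. open X \<Longrightarrow> X \<noteq> {} \<Longrightarrow> \<exists>d\<in>B. d \<in> X"
    using countable_dense_exists by blast
  define dev where "dev = (\<lambda>\<beta> z. \<Sum>i\<in>{..<n}. (\<integral>x. \<bar>w x \<bullet> u \<beta>\<bar> powr r \<partial>P) - \<bar>w (z i) \<bullet> u \<beta>\<bar> powr r)"
  define bad where "bad = (\<lambda>z. \<exists>\<beta>\<in>B. T < dev \<beta> z)"
  have devm: "dev \<beta> \<in> borel_measurable (PiM {..<n} (\<lambda>_. P))" for \<beta>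
    unfolding dev_def
  proof (intro borel_measurable_sum borel_measurable_diff borel_measurable_const)
    fix i assume i: "i \<in> {..<n}"
    have "(\<lambda>x. \<bar>w x \<bullet> u \<beta>\<bar> powr r) \<in> borel_measurable P" using wm by measurable
    then show "(\<lambda>z. \<bar>w (z i) \<bullet> u \<beta>\<bar> powr r) \<in> borel_measurable (PiM {..<n} (\<lambda>_. P))"
      by (rule measurable_compose[OF measurable_component_singleton[OF i]])
  qed
  have badU: "bad z \<longleftrightarrow> (\<exists>v\<in>u ` B. T < (\<Sum>i\<in>{..<n}. (\<integral>x. \<bar>w x \<bullet> v\<bar> powr r \<partial>P) - \<bar>w (z i) \<bullet> v\<bar> powr r))" for z
    by (simp add: bad_def dev_def)
  have badm: "{z \<in> space (PiM {..<n} (\<lambda>_. P)). bad z} \<in> sets (PiM {..<n} (\<lambda>_. P))"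
    unfolding bad_def using B(1) devm by (intro sets.sets_Collect_countable_Ex' borel_measurable_less) auto
  have badloc: "bad (\<lambda>i\<in>{..<n}. z i) \<longleftrightarrow> bad z" for z by (simp add: bad_def dev_def)
  have sample: "{\<omega> \<in> space M. bad (\<lambda>i. Z i \<omega>)} \<in> sets M"
    "emeasure M {\<omega> \<in> space M. bad (\<lambda>i. Z i \<omega>)}
      = emeasure (PiM {..<n} (\<lambda>_. P)) {z \<in> space (PiM {..<n} (\<lambda>_. P)). bad z}"
    using indep_sample_emeasure[OF \<open>prob_space M\<close> setsP n1 assms(12,13) badm badloc] by simp_all
  have "emeasure (PiM {..<n} (\<lambda>_. P)) {z \<in> space (PiM {..<n} (\<lambda>_. P)). bad z}
      \<le> ennreal (4 * card {..<n} * (DIM((real^'d) \<times> real) * (r\<^sup>2 * \<kappa>)) / T\<^sup>2)"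
    unfolding badU
  proof (rule uniform_lower_deviation[OF \<open>prob_space P\<close> r1 _ _ wm Dm _ \<kappa>0 env T0])
    show "countable (u ` B)" using B(1) by (rule countable_image)
  qed (use wD in auto)
  also have "4 * card {..<n} * (DIM((real^'d) \<times> real) * (r\<^sup>2 * \<kappa>)) / T\<^sup>2 \<le> \<alpha>"
  proof -
    have "4 * card {..<n} * (DIM((real^'d) \<times> real) * (r\<^sup>2 * \<kappa>)) = real n * (8 * 4 powr r * r\<^sup>2 * (real CARD('d) + 1))"
      by (simp add: \<kappa>_def)
    also have "\<dots> \<le> real n * (16 * 4 powr r * r\<^sup>2 * (real CARD('d) + 2))"
      by (intro mult_left_mono mult_mono) auto
    also have "\<dots> \<le> real n * (\<alpha> * C\<^sup>2)" by (intro mult_left_mono Cb) simp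
    also have "\<dots> \<le> real n * (\<alpha> * (C\<^sup>2 * L\<^sup>2))"
      using L1 \<alpha>0 by (intro mult_left_mono) (auto simp: mult_le_cancel_left1)
    also have "\<dots> = \<alpha> * T\<^sup>2" by (simp add: T_def power_mult_distrib)
    finally show ?thesis using T0 by (simp add: divide_le_eq)
  qed
  finally have "emeasure M {\<omega> \<in> space M. bad (\<lambda>i. Z i \<omega>)} \<le> ennreal \<alpha>"
    unfolding sample(2) by (simp add: ennreal_leI)
  then have badprob: "M.prob {\<omega> \<in> space M. bad (\<lambda>i. Z i \<omega>)} \<le> \<alpha>"
    using \<alpha>0 by (simp add: M.emeasure_eq_measure)
  define p q where "p = (\<lambda>\<beta>. \<integral>z. \<bar>resid \<beta> z\<bar> powr r \<partial>P)" and "q = (\<lambda>\<beta>. \<integral>z. \<bar>resid \<beta> z\<bar> powr r \<partial>Q)"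
  define e where "e = (\<lambda>\<omega> \<beta>. (\<Sum>i<n. \<bar>resid \<beta> (Z i \<omega>)\<bar> powr r) / n)"
  define c where "c = (\<lambda>\<beta>. (\<delta> + \<epsilon>) * (\<sigma> + \<rho> \<beta>))"
  have resP: "resid \<beta> \<in> borel_measurable P" and resQ: "resid \<beta> \<in> borel_measurable Q" for \<beta>
    unfolding measurable_cong_sets[OF setsP refl] measurable_cong_sets[OF setsQ refl] by measurable
  have pint: "integrable P (\<lambda>z. \<bar>resid \<beta> z\<bar> powr r)" for \<beta>
  proof -
    have "integrable P (\<lambda>z. \<bar>w z \<bullet> u \<beta>\<bar> powr r)"
    proof (rule integrable_abs_powr_envelope[OF \<open>prob_space P\<close> r1 _ Dm])
      show "(\<integral>\<^sup>+ z. ennreal ((a z + b z) powr (2 * r)) \<partial>P) < \<infinity>" using env by (rule le_less_trans) simp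
    qed (use wm wD in auto)
    then have "integrable P (\<lambda>z. k \<beta> powr r * \<bar>resid \<beta> z\<bar> powr r)"
      unfolding wu abs_mult using kpos[of \<beta>] by (simp add: powr_mult)
    then show ?thesis using kpos[of \<beta>] by simp
  qed
  have lpP: "lp_moment r P (resid \<beta>) = ennreal (p \<beta> powr (1 / r))" for \<beta>
    unfolding p_def by (rule lp_moment_eq_integral[OF pint])
  have lpQle: "lp_moment r Q (resid \<beta>) \<le> ennreal (p \<beta> powr (1 / r) + \<epsilon> * (\<sigma> + \<rho> \<beta>))" for \<beta>
    using lp_moment_resid_wasserstein[OF r1 pos \<epsilon>0 _ assms(23)] lpP by simp
  have qint: "integrable Q (\<lambda>z. \<bar>resid \<beta> z\<bar> powr r)" for \<beta>
    using lpQle[of \<beta>] by (intro integrable_if_lp_moment_finite resQ) (auto intro: le_less_trans)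
  have lpQ: "lp_moment r Q (resid \<beta>) = ennreal (q \<beta> powr (1 / r))" for \<beta>
    unfolding q_def by (rule lp_moment_eq_integral[OF qint])
  have qp: "q \<beta> powr (1 / r) \<le> p \<beta> powr (1 / r) + \<epsilon> * (\<sigma> + \<rho> \<beta>)" for \<beta>
    using lpQle[of \<beta>] \<epsilon>0 pos[of \<beta>] unfolding lpQ by (subst (asm) ennreal_le_iff) auto
  have lpE: "lp_moment r (empirical_measure n (\<lambda>i. Z i \<omega>)) (resid \<beta>) = ennreal (e \<omega> \<beta> powr (1 / r))" for \<omega> \<beta>
    unfolding e_def by (rule lp_moment_empirical[OF n1 resid_measurable])
  have p0: "0 \<le> p \<beta>" and q0: "0 \<le> q \<beta>" and e0: "0 \<le> e \<omega> \<beta>" for \<beta> \<omega>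
    unfolding p_def q_def e_def by (auto intro!: integral_nonneg_AE divide_nonneg_nonneg sum_nonneg)
  define X where "X = C * L / sqrt (real n)"
  have X0: "0 \<le> X" using C0 L1 by (simp add: X_def)
  have \<delta>X: "\<delta> = max (1 / c\<^sub>d) 1 * X powr (1 / r)" unfolding assms(19) X_def L_def ..
  have \<delta>0: "0 \<le> \<delta>" unfolding \<delta>X by simp
  have c0': "0 \<le> c \<beta>" for \<beta> using \<delta>0 \<epsilon>0 pos[of \<beta>] by (simp add: c_def)
  \<comment> \<open>Undoing the normalisation divides the deviation \<open>X\<close> by \<open>k \<beta> powr r\<close>; after the \<open>r\<close>-th root this
    becomes the factor \<open>(\<sigma> + \<rho> \<beta>) / c\<^sub>d\<close>.\<close>
  have good: "q \<beta> powr (1 / r) \<le> e \<omega> \<beta> powr (1 / r) + c \<beta>"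
    if "\<not> bad (\<lambda>i. Z i \<omega>)" "\<beta> \<in> B" for \<omega> \<beta>
  proof -
    have kr: "0 < k \<beta> powr r" using kpos[of \<beta>] by simp
    have f: "\<bar>w z \<bullet> u \<beta>\<bar> powr r = k \<beta> powr r * \<bar>resid \<beta> z\<bar> powr r" for z
      unfolding wu abs_mult using kpos[of \<beta>] by (simp add: powr_mult)
    have "dev \<beta> (\<lambda>i. Z i \<omega>) = k \<beta> powr r * (real n * (p \<beta> - e \<omega> \<beta>))"
    proof -
      have "dev \<beta> (\<lambda>i. Z i \<omega>) = (\<Sum>i<n. k \<beta> powr r * (p \<beta> - \<bar>resid \<beta> (Z i \<omega>)\<bar> powr r))"
        unfolding dev_def f p_def by (simp add: right_diff_distrib)
      also have "\<dots> = k \<beta> powr r * (real n * p \<beta> - (\<Sum>i<n. \<bar>resid \<beta> (Z i \<omega>)\<bar> powr r))"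
        by (simp add: sum_distrib_left[symmetric] sum_subtractf)
      also have "(\<Sum>i<n. \<bar>resid \<beta> (Z i \<omega>)\<bar> powr r) = real n * e \<omega> \<beta>" using n1 by (simp add: e_def)
      finally show ?thesis by (simp add: right_diff_distrib)
    qed
    moreover have "dev \<beta> (\<lambda>i. Z i \<omega>) \<le> T" using that by (auto simp: bad_def not_less)
    moreover have "T = real n * X" using n1 by (simp add: T_def X_def real_div_sqrt field_simps)
    ultimately have "real n * (k \<beta> powr r * (p \<beta> - e \<omega> \<beta>)) \<le> real n * X" by (simp add: mult.left_commute)
    then have "k \<beta> powr r * (p \<beta> - e \<omega> \<beta>) \<le> X" using n1 by simp
    then have "p \<beta> \<le> e \<omega> \<beta> + X / k \<beta> powr r" using kr by (simp add: field_simps)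
    then have "p \<beta> powr (1 / r) \<le> (e \<omega> \<beta> + X / k \<beta> powr r) powr (1 / r)"
      using r1 p0 by (intro powr_mono2) auto
    also have "\<dots> \<le> e \<omega> \<beta> powr (1 / r) + (X / k \<beta> powr r) powr (1 / r)"
      using r1 e0 X0 by (intro powr_add_le_subadditive) auto
    also have "(X / k \<beta> powr r) powr (1 / r) = (1 / c\<^sub>d) * X powr (1 / r) * (\<sigma> + \<rho> \<beta>)"
    proof -
      have "(X / k \<beta> powr r) powr (1 / r) = X powr (1 / r) / k \<beta>"
        using X0 kpos[of \<beta>] r1 by (simp add: powr_divide powr_powr)
      then show ?thesis by (simp add: k_def)
    qed
    also have "\<dots> \<le> \<delta> * (\<sigma> + \<rho> \<beta>)"
      unfolding \<delta>X using pos[of \<beta>] by (intro mult_right_mono) auto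
    finally show ?thesis using qp[of \<beta>] by (simp add: c_def distrib_right)
  qed
  have cq: "continuous_on UNIV (\<lambda>\<beta>. q \<beta> powr (1 / r))"
    unfolding q_def using r1 q0 by (intro continuous_on_powr' continuous_integral_resid_powr qint continuous_on_const)
      (auto simp: q_def)
  have cec: "continuous_on UNIV (\<lambda>\<beta>. e \<omega> \<beta> powr (1 / r) + c \<beta>)" for \<omega>
  proof -
    have "continuous_on UNIV \<rho>" using \<rho>pen by (intro convex_on_continuous) (auto simp: convex_penalty_def)
    then have "continuous_on UNIV c" unfolding c_def by (intro continuous_intros)
    moreover have "continuous_on UNIV (\<lambda>\<beta>. e \<omega> \<beta>)"
      unfolding e_def resid_def using r1 n1 by (intro continuous_intros continuous_on_powr') auto
    then have "continuous_on UNIV (\<lambda>\<beta>. e \<omega> \<beta> powr (1 / r))"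
      using r1 e0 by (intro continuous_on_powr' continuous_on_const) auto
    ultimately show ?thesis by (intro continuous_on_add)
  qed
  let ?S = "{\<omega> \<in> space M. \<forall>\<beta>. lp_moment r Q (resid \<beta>)
             \<le> lp_moment r (empirical_measure n (\<lambda>i. Z i \<omega>)) (resid \<beta>) + ennreal ((\<delta> + \<epsilon>) * (\<sigma> + \<rho> \<beta>))}"
  have ineq: "lp_moment r Q (resid \<beta>)
        \<le> lp_moment r (empirical_measure n (\<lambda>i. Z i \<omega>)) (resid \<beta>) + ennreal ((\<delta> + \<epsilon>) * (\<sigma> + \<rho> \<beta>))
      \<longleftrightarrow> q \<beta> powr (1 / r) \<le> e \<omega> \<beta> powr (1 / r) + c \<beta>" for \<omega> \<beta>
  proof -
    have "ennreal (e \<omega> \<beta> powr (1 / r)) + ennreal ((\<delta> + \<epsilon>) * (\<sigma> + \<rho> \<beta>))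
        = ennreal (e \<omega> \<beta> powr (1 / r) + c \<beta>)"
      using c0'[of \<beta>] unfolding c_def by (intro ennreal_plus[symmetric]) auto
    then show ?thesis unfolding lpQ lpE using c0'[of \<beta>] by (simp only:) (rule ennreal_le_iff, simp)
  qed
  \<comment> \<open>Restricting to the countable set \<open>B\<close> makes the event measurable.\<close>
  have S: "?S = {\<omega> \<in> space M. \<forall>\<beta>\<in>B. q \<beta> powr (1 / r) \<le> e \<omega> \<beta> powr (1 / r) + c \<beta>}"
    unfolding ineq using le_everywhere_if_le_on_dense[OF cq cec B(2)] by blast
  have em: "(\<lambda>\<omega>. e \<omega> \<beta> powr (1 / r) + c \<beta>) \<in> borel_measurable M" for \<beta>
  proof -
    have "(\<lambda>\<omega>. \<bar>resid \<beta> (Z i \<omega>)\<bar> powr r) \<in> borel_measurable M" if "i \<in> {..<n}" for i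
    proof -
      have "Z i \<in> measurable M borel" using assms(12) that unfolding M.indep_vars_def by blast
      moreover have "(\<lambda>z. \<bar>resid \<beta> z\<bar> powr r) \<in> borel_measurable borel" by measurable
      ultimately show ?thesis by (rule measurable_compose)
    qed
    then have "(\<lambda>\<omega>. e \<omega> \<beta>) \<in> borel_measurable M"
      unfolding e_def by (intro borel_measurable_divide borel_measurable_sum borel_measurable_const) auto
    then show ?thesis by measurable
  qed
  have Sm: "?S \<in> sets M"
    unfolding S using B(1) em by (intro sets.sets_Collect_countable_All' borel_measurable_le) auto
  have "space M - {\<omega> \<in> space M. bad (\<lambda>i. Z i \<omega>)} \<subseteq> ?S" unfolding S using good by blast
  then have "M.prob (space M - {\<omega> \<in> space M. bad (\<lambda>i. Z i \<omega>)}) \<le> M.prob ?S"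
    by (rule M.finite_measure_mono) (rule Sm)
  moreover have "M.prob (space M - {\<omega> \<in> space M. bad (\<lambda>i. Z i \<omega>)}) \<ge> 1 - \<alpha>"
    using M.prob_compl[OF sample(1)] badprob by simp
  ultimately show ?thesis using \<alpha>0 by simp
qed

end
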